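(* There exist absolute constants $C_1,C_2>0$ such that the following holds. Let $d,n\ge1$, $0<\epsilon<1/2$, $0<\tau<1$. Let $S$ be a multiset of $n$ i.i.d. points from a distribution $P$ on $\mathbb{R}^d$ with mean $\mu$ and (finite, nonzero) covariance $\Sigma$, and let $T$ be an $\epsilon$-corrupted version of $S$. Put $\epsilon'=C_1\left(\epsilon+\frac{\log(1/\tau)}{n}\right)$ and $k=\lfloor\epsilon' n\rfloor$, and assume $1\le k\le n$. Let $T_k$ be the multiset of $k$ points obtained by median-of-means pre-processing with $k$ buckets on $T$. Then, with probability at least $1-\tau$ (over the samples and the random bucketing), $T_k$ is a $0.01$-corrupted version of a multiset $S_k$ of $k$ points for which there exists $S_k'\subseteq S_k$ with $|S_k'|\ge0.95k$ such that $S_k'$ is $(0.1,\delta)$-stable with respect to $\mu$ and $k\|\Sigma\|/n$, where $\delta=C_2\left(\sqrt{\mathrm{r}(\Sigma)/k}+1\right)$.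
   Context: $\|\cdot\|$ is the Euclidean norm of a vector and the spectral norm of a matrix; $\mathrm{r}(\Sigma)=\operatorname{tr}(\Sigma)/\|\Sigma\|$ for nonzero PSD $\Sigma$. Corruption (strong contamination model). $T$ is an $\epsilon$-corrupted version of a finite multiset $S$ if $T$ is obtained from $S$ by removing at most $\epsilon|S|$ points and replacing them by the same number of arbitrary points; the adversary may inspect $S$ before choosing removals and replacements. Median-of-means pre-processing with $k$ buckets: given a multiset of $n$ points, partition it uniformly at random (independently of everything else) into $k$ disjoint buckets of equal size (if $k$ does not divide $n$, first remove some samples), and output the empirical means $z_1,\dots,z_k$ of the buckets. Stability. For a finite multiset $S\subset\mathbb{R}^d$ and a fixed $\mu\in\mathbb{R}^d$, let $\mu_S=\frac1{|S|}\sum_{x\in S}x$ and $\overline{\Sigma}_S=\frac1{|S|}\sum_{x\in S}(x-\mu)(x-\mu)^T$. For $0<\epsilon<1/2$ and $\delta\ge\epsilon$, $S$ is $(\epsilon,\delta)$-stable with respect to $\mu$ and $\sigma^2$ if for every $S'\subseteq S$ with $|S'|\ge(1-\epsilon)|S|$: (i) $\|\mu_{S'}-\mu\|\le\sigma\delta$, and (ii) $\|\overline{\Sigma}_{S'}-\sigma^2 I\|\le\sigma^2\delta^2/\epsilon$. *)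

theory Defs
  imports "HOL-Probability.Probability"
begin

(* The dimension d has to be quantified inside the statement (the constants do not depend on it),
   so R^d is the set of functions nat => real that are extensional on {..<d}, with its Borel
   sigma-algebra given by the finite product measure space. Matrices are functions
   nat => nat => real of which only the entries with indices below d matter. *)

definition Rd :: "nat \<Rightarrow> (nat \<Rightarrow> real) measure" where
  "Rd d = (\<Pi>\<^sub>M i\<in>{..<d}. borel)"

definition vec_norm :: "nat \<Rightarrow> (nat \<Rightarrow> real) \<Rightarrow> real" where
  "vec_norm d x = L2_set x {..<d}"

definition mat_vec :: "nat \<Rightarrow> (nat \<Rightarrow> nat \<Rightarrow> real) \<Rightarrow> (nat \<Rightarrow> real) \<Rightarrow> nat \<Rightarrow> real" where
  "mat_vec d A x = (\<lambda>i. \<Sum>j<d. A i j * x j)"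

definition spectral_norm :: "nat \<Rightarrow> (nat \<Rightarrow> nat \<Rightarrow> real) \<Rightarrow> real" where
  "spectral_norm d A = (SUP x\<in>{x. vec_norm d x \<le> 1}. vec_norm d (mat_vec d A x))"

definition mat_trace :: "nat \<Rightarrow> (nat \<Rightarrow> nat \<Rightarrow> real) \<Rightarrow> real" where
  "mat_trace d A = (\<Sum>i<d. A i i)"

definition id_mat :: "nat \<Rightarrow> nat \<Rightarrow> real" where
  "id_mat i j = (if i = j then 1 else 0)"

definition eff_rank :: "nat \<Rightarrow> (nat \<Rightarrow> nat \<Rightarrow> real) \<Rightarrow> real" where
  "eff_rank d A = mat_trace d A / spectral_norm d A"

definition mean_vec :: "(nat \<Rightarrow> real) measure \<Rightarrow> nat \<Rightarrow> real" where
  "mean_vec P i = (\<integral>x. x i \<partial>P)"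

definition cov_mat :: "(nat \<Rightarrow> real) measure \<Rightarrow> nat \<Rightarrow> nat \<Rightarrow> real" where
  "cov_mat P i j = (\<integral>x. (x i - mean_vec P i) * (x j - mean_vec P j) \<partial>P)"

definition emp_mean :: "nat \<Rightarrow> (nat \<Rightarrow> real) multiset \<Rightarrow> nat \<Rightarrow> real" where
  "emp_mean d S = (\<lambda>i\<in>{..<d}. (\<Sum>x\<in>#S. x i) / real (size S))"

(* centred at the given point \<mu>, not at the empirical mean *)
definition emp_cov :: "(nat \<Rightarrow> real) \<Rightarrow> (nat \<Rightarrow> real) multiset \<Rightarrow> nat \<Rightarrow> nat \<Rightarrow> real" where
  "emp_cov \<mu> S i j = (\<Sum>x\<in>#S. (x i - \<mu> i) * (x j - \<mu> j)) / real (size S)"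

definition is_stable ::
  "nat \<Rightarrow> real \<Rightarrow> real \<Rightarrow> (nat \<Rightarrow> real) \<Rightarrow> real \<Rightarrow> (nat \<Rightarrow> real) multiset \<Rightarrow> bool" where
  "is_stable d \<epsilon> \<delta> \<mu> \<sigma>2 S \<longleftrightarrow>
     0 < \<epsilon> \<and> \<epsilon> < 1/2 \<and> \<epsilon> \<le> \<delta> \<and>
     (\<forall>S'. S' \<subseteq># S \<and> real (size S') \<ge> (1 - \<epsilon>) * real (size S) \<longrightarrow>
        vec_norm d (\<lambda>i. emp_mean d S' i - \<mu> i) \<le> sqrt \<sigma>2 * \<delta> \<and>
        spectral_norm d (\<lambda>i j. emp_cov \<mu> S' i j - \<sigma>2 * id_mat i j) \<le> \<sigma>2 * \<delta>\<^sup>2 / \<epsilon>)"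

definition corrupted :: "real \<Rightarrow> 'a multiset \<Rightarrow> 'a multiset \<Rightarrow> bool" where
  "corrupted \<epsilon> T S \<longleftrightarrow>
     (\<exists>R A. R \<subseteq># S \<and> real (size R) \<le> \<epsilon> * real (size S) \<and> size A = size R \<and> T = S - R + A)"

definition points :: "('i \<Rightarrow> 'a) \<Rightarrow> 'i set \<Rightarrow> 'a multiset" where
  "points s I = image_mset s (mset_set I)"

(* A sample of n points is an enumerated multiset: a function on the indices {..<n}. *)
definition sample_space :: "nat \<Rightarrow> nat \<Rightarrow> (nat \<Rightarrow> nat \<Rightarrow> real) measure" where
  "sample_space d n = (\<Pi>\<^sub>M i\<in>{..<n}. Rd d)"

(* The possible bucketings of n samples: retain a set I of samples, dropping n mod k of them,
   and partition I into k buckets of n div k samples each. The dropped samples are part of the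
   random choice, so the law of the bucket means depends only on the multiset of input points
   and not on its enumeration. *)
definition bucketings :: "nat \<Rightarrow> nat \<Rightarrow> nat set set set" where
  "bucketings n k =
     {\<B>. (\<exists>I\<subseteq>{..<n}. partition_on I \<B>) \<and> card \<B> = k \<and> (\<forall>B\<in>\<B>. card B = n div k)}"

definition bucket_means :: "nat \<Rightarrow> (nat \<Rightarrow> nat \<Rightarrow> real) \<Rightarrow> nat set set \<Rightarrow> (nat \<Rightarrow> real) multiset" where
  "bucket_means d t \<B> = image_mset (\<lambda>B. emp_mean d (points t B)) (mset_set \<B>)"

(* L is the joint law of the n i.i.d. points from P and of the corrupted points. The coupling is
   otherwise arbitrary, so the adversary may look at the whole sample and may randomise, and the
   enumeration of the corrupted points is not aligned with that of the sample. *)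
definition corrupted_sample_law ::
  "nat \<Rightarrow> nat \<Rightarrow> real \<Rightarrow> (nat \<Rightarrow> real) measure \<Rightarrow>
     ((nat \<Rightarrow> nat \<Rightarrow> real) \<times> (nat \<Rightarrow> nat \<Rightarrow> real)) measure \<Rightarrow> bool" where
  "corrupted_sample_law d n \<epsilon> P L \<longleftrightarrow>
     prob_space L \<and> sets L = sets (sample_space d n \<Otimes>\<^sub>M sample_space d n) \<and>
     distr L (sample_space d n) fst = (\<Pi>\<^sub>M i\<in>{..<n}. P) \<and>
     (AE (s, t) in L. corrupted \<epsilon> (points t {..<n}) (points s {..<n}))"

end

theory Submission
  imports Defs
begin

text \<open>
  Let \<open>y\<^sub>1, \<dots>, y\<^sub>k\<close> be the centred bucket means of the uncorrupted sample. Stability with respect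
  to subsets of a fixed proportion only needs most of the \<open>y\<^sub>b\<close> to satisfy \<open>\<Sum>\<^sub>b (v \<bullet> y\<^sub>b)\<^sup>2 \<le> K |v|\<^sup>2\<close> for all \<open>v\<close>.

  PAC-Bayes: with a Gaussian prior \<open>g\<close> of variance \<open>1/\<beta>\<close>, the shift of \<open>g\<close> by \<open>v\<close> has relative entropy
  \<open>\<beta> |v|\<^sup>2 / 2\<close>, so one exponential moment, controlled by Markov's inequality with probability \<open>1 - \<tau>\<close>,
  bounds \<open>E\<^sub>g \<Sum>\<^sub>b (1 - cos ((v + g) \<bullet> y\<^sub>b))\<close> for all \<open>v\<close> simultaneously. Averaging over the signs in
  \<open>v = \<Sum>\<^sub>j \<plusminus>u\<^sub>j\<close> turns the cosines into the weights \<open>w\<^sub>b = \<Prod>\<^sub>j cos (u\<^sub>j \<bullet> y\<^sub>b)\<close> and bounds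
  \<open>\<Sum>\<^sub>b (1 - w\<^sub>b)\<close> in terms of \<open>\<Sum>\<^sub>j |u\<^sub>j|\<^sup>2\<close>.

  If the \<open>u\<^sub>j\<close> are short vectors that almost minimise \<open>\<Sum>\<^sub>b w\<^sub>b + \<Lambda> \<Sum>\<^sub>j |u\<^sub>j|\<^sup>2\<close>, then appending one more vector
  cannot help, which says that \<open>\<Sum>\<^sub>b w\<^sub>b (v \<bullet> y\<^sub>b)\<^sup>2 \<le> 8 \<Lambda> |v|\<^sup>2\<close>. The buckets with \<open>w\<^sub>b \<ge> 1/2\<close> are the
  desired ones, and all but \<open>2 \<Sum>\<^sub>b (1 - w\<^sub>b)\<close> buckets are of this kind.

  Aligning the corrupted sample with the clean one by a permutation of the indices preserves
  the uniform law of the bucketing, even though the permutation depends on both samples.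
\<close>

section \<open>Vectors, matrices and stability\<close>

definition ip :: "nat \<Rightarrow> (nat \<Rightarrow> real) \<Rightarrow> (nat \<Rightarrow> real) \<Rightarrow> real" where
  "ip d x y = (\<Sum>i<d. x i * y i)"

definition quad :: "nat \<Rightarrow> (nat \<Rightarrow> nat \<Rightarrow> real) \<Rightarrow> (nat \<Rightarrow> real) \<Rightarrow> real" where
  "quad d A x = (\<Sum>i<d. \<Sum>j<d. A i j * (x i * x j))"

lemma ip_self_nonneg: "0 \<le> ip d x x"
  by (simp add: ip_def sum_nonneg)

lemma ip_add_left: "ip d (\<lambda>i. x i + y i) z = ip d x z + ip d y z"
  by (simp add: ip_def sum.distrib algebra_simps)

lemma ip_diff_left: "ip d (\<lambda>i. x i - y i) z = ip d x z - ip d y z"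
  by (simp add: ip_def sum_subtractf algebra_simps)

lemma ip_scale_left: "ip d (\<lambda>i. c * x i) z = c * ip d x z"
  by (simp add: ip_def sum_distrib_left algebra_simps)

lemma ip_scale_right: "ip d z (\<lambda>i. c * x i) = c * ip d z x"
  by (simp add: ip_def sum_distrib_left algebra_simps)

lemma vec_norm_ip: "vec_norm d x = sqrt (ip d x x)"
  by (simp add: vec_norm_def L2_set_def ip_def power2_eq_square)

lemma vec_norm_sq: "(vec_norm d x)\<^sup>2 = ip d x x"
  by (simp add: vec_norm_ip ip_self_nonneg)

lemma vec_norm_nonneg: "0 \<le> vec_norm d x"
  by (simp add: vec_norm_ip ip_self_nonneg)

lemma vec_norm_scale: "vec_norm d (\<lambda>i. c * x i) = \<bar>c\<bar> * vec_norm d x"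
  by (simp add: vec_norm_ip ip_scale_left ip_scale_right real_sqrt_mult mult.assoc[symmetric]
      power2_eq_square[symmetric])

lemma vec_norm_diff_le: "vec_norm d (\<lambda>i. x i - y i) \<le> vec_norm d x + vec_norm d y"
  using L2_set_triangle_ineq[of x "\<lambda>i. - y i" "{..<d}"] by (simp add: vec_norm_def L2_set_def)

lemma ip_Cauchy_Schwarz: "(ip d x y)\<^sup>2 \<le> ip d x x * ip d y y"
  using Cauchy_Schwarz_ineq_sum[of x y "{..<d}"] by (simp add: ip_def power2_eq_square)

lemma abs_ip_le: "\<bar>ip d x y\<bar> \<le> vec_norm d x * vec_norm d y"
proof -
  have "sqrt ((ip d x y)\<^sup>2) \<le> sqrt (ip d x x * ip d y y)"
    using ip_Cauchy_Schwarz real_sqrt_le_mono by blast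
  then show ?thesis by (simp add: vec_norm_ip real_sqrt_mult)
qed

text \<open>A supremum of reals carries information only when the set is bounded; the sum of the row
  norms is a crude bound that makes \<open>spectral_norm\<close> a genuine operator norm.\<close>

lemma bdd_above_mat_vec: "bdd_above ((\<lambda>x. vec_norm d (mat_vec d A x)) ` {x. vec_norm d x \<le> 1})"
proof (rule bdd_aboveI2)
  fix x assume "x \<in> {x. vec_norm d x \<le> 1}"
  then have x: "vec_norm d x \<le> 1" by simp
  have "vec_norm d (mat_vec d A x) \<le> (\<Sum>i<d. \<bar>mat_vec d A x i\<bar>)"
    unfolding vec_norm_def by (rule L2_set_le_sum_abs)
  also have "\<dots> \<le> (\<Sum>i<d. vec_norm d (A i))"
  proof (rule sum_mono)
    fix i
    have "\<bar>mat_vec d A x i\<bar> \<le> vec_norm d (A i) * vec_norm d x"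
      using abs_ip_le[of d "A i" x] by (simp add: mat_vec_def ip_def)
    also have "\<dots> \<le> vec_norm d (A i)"
      using mult_left_mono[OF x vec_norm_nonneg[of d "A i"]] by simp
    finally show "\<bar>mat_vec d A x i\<bar> \<le> vec_norm d (A i)" .
  qed
  finally show "vec_norm d (mat_vec d A x) \<le> (\<Sum>i<d. vec_norm d (A i))" .
qed

lemma mat_vec_scale: "mat_vec d A (\<lambda>i. c * x i) = (\<lambda>i. c * mat_vec d A x i)"
  by (simp add: mat_vec_def sum_distrib_left mult.left_commute)

lemma mat_vec_zero:
  assumes "vec_norm d x = 0"
  shows "mat_vec d A x = (\<lambda>_. 0)"
proof -
  have "x i = 0" if "i < d" for i
    using assms that by (simp add: vec_norm_def L2_set_eq_0_iff)
  then show ?thesis by (simp add: mat_vec_def)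
qed

lemma vec_norm_mat_vec_le: "vec_norm d (mat_vec d A x) \<le> spectral_norm d A * vec_norm d x"
proof (cases "vec_norm d x = 0")
  case True
  then show ?thesis by (simp add: mat_vec_zero vec_norm_def L2_set_def)
next
  case False
  define c where "c = vec_norm d x"
  have c: "c > 0" using False vec_norm_nonneg[of d x] by (simp add: c_def)
  have "vec_norm d (\<lambda>i. inverse c * x i) \<le> 1"
    using c unfolding vec_norm_scale c_def[symmetric] by simp
  then have "vec_norm d (mat_vec d A (\<lambda>i. inverse c * x i)) \<le> spectral_norm d A"
    unfolding spectral_norm_def by (intro cSUP_upper bdd_above_mat_vec) simp
  then have "inverse c * vec_norm d (mat_vec d A x) \<le> spectral_norm d A"
    using c by (simp add: mat_vec_scale vec_norm_scale)
  then show ?thesis using c by (simp add: c_def[symmetric] field_simps)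
qed

lemma quad_eq_ip: "quad d A x = ip d x (mat_vec d A x)"
  by (simp add: quad_def ip_def mat_vec_def sum_distrib_left algebra_simps)

lemma quad_le_spectral_norm: "quad d A x \<le> spectral_norm d A * ip d x x"
proof -
  have "quad d A x \<le> vec_norm d x * vec_norm d (mat_vec d A x)"
    using abs_ip_le[of d x "mat_vec d A x"] by (simp add: quad_eq_ip)
  also have "\<dots> \<le> vec_norm d x * (spectral_norm d A * vec_norm d x)"
    by (intro mult_left_mono vec_norm_mat_vec_le vec_norm_nonneg)
  finally show ?thesis by (simp add: vec_norm_sq[symmetric] power2_eq_square algebra_simps)
qed

text \<open>The unit vector \<open>?e\<close> picks out the \<open>j\<close>-th column, whose norm
  dominates each of its entries. A nonzero covariance thereby becomes a positive divisor in the
  effective rank.\<close>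

lemma spectral_norm_pos:
  assumes "i < d" "j < d" "A i j \<noteq> 0"
  shows "0 < spectral_norm d A"
proof -
  let ?e = "\<lambda>l. if l = j then 1 else 0 :: real"
  have e: "vec_norm d ?e = 1"
    using assms(2) by (simp add: vec_norm_ip ip_def if_distrib[where f="\<lambda>x. x * _"] cong: if_cong)
  have m: "mat_vec d A ?e = (\<lambda>i. A i j)"
    using assms(2) by (simp add: mat_vec_def if_distrib cong: if_cong)
  have "\<bar>A i j\<bar> \<le> vec_norm d (\<lambda>i. A i j)"
    using assms(1) member_le_L2_set[of "{..<d}" i "\<lambda>i. \<bar>A i j\<bar>"]
    by (simp add: vec_norm_def L2_set_def)
  also have "\<dots> \<le> spectral_norm d A"
    using vec_norm_mat_vec_le[of d A ?e] by (simp add: e m)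
  finally show ?thesis using assms(3) by simp
qed

lemma spectral_norm_leI:
  assumes "\<And>x. vec_norm d x \<le> 1 \<Longrightarrow> vec_norm d (mat_vec d A x) \<le> K"
  shows "spectral_norm d A \<le> K"
  unfolding spectral_norm_def
proof (rule cSUP_least)
  have "vec_norm d (\<lambda>_. 0) \<le> 1" by (simp add: vec_norm_def L2_set_def)
  then show "{x. vec_norm d x \<le> 1} \<noteq> {}" by blast
qed (use assms in auto)

section \<open>Stability from a bound on second moments\<close>

lemma Cauchy_Schwarz_sum_mset:
  fixes f g :: "'a \<Rightarrow> real"
  shows "(\<Sum>x\<in>#M. f x * g x)\<^sup>2 \<le> (\<Sum>x\<in>#M. (f x)\<^sup>2) * (\<Sum>x\<in>#M. (g x)\<^sup>2)"
proof -
  obtain xs where M: "M = mset xs" by (metis ex_mset)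
  have *: "(\<Sum>x\<in>#M. h x) = (\<Sum>i<length xs. h (xs ! i))" for h :: "'a \<Rightarrow> real"
    by (simp add: M sum_mset_sum_list sum_list_sum_nth atLeast0LessThan flip: mset_map)
  show ?thesis unfolding * by (rule Cauchy_Schwarz_ineq_sum)
qed

lemma sum_mset_power2_nonneg: "0 \<le> (\<Sum>x\<in>#M. (f x :: real)\<^sup>2)"
  by (induction M) auto

lemma sum_sum_mset_swap:
  fixes f :: "'a \<Rightarrow> 'b \<Rightarrow> real"
  shows "(\<Sum>i\<in>A. \<Sum>x\<in>#M. f i x) = (\<Sum>x\<in>#M. \<Sum>i\<in>A. f i x)"
  by (induction M) (auto simp: sum.distrib)

lemma sum_mset_divide: "(\<Sum>x\<in>#M. f x) / c = (\<Sum>x\<in>#M. f x / (c :: real))"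
  by (induction M) (auto simp: add_divide_distrib)

lemma le_of_mult_self_le:
  fixes a c :: real
  assumes "a * a \<le> c * a" "0 \<le> a" "0 \<le> c"
  shows "a \<le> c"
  using assms by (cases "a = 0") auto

text \<open>The sum of squares can only decrease on a sub-multiset, and every \<open>S'\<close> that
  stability quantifies over still has at least \<open>N\<close> points. Hence its second moment in a
  unit direction is at most \<open>K / N\<close>, and Cauchy-Schwarz turns this into bounds on the
  mean and on the covariance. The multiple of the identity is split off by the triangle inequality,
  at a cost of at most \<open>s2\<close>.\<close>

lemma stable_of_second_moment_bound:
  assumes bound: "\<And>v. (\<Sum>x\<in>#S. (ip d v (\<lambda>i. x i - \<mu> i))\<^sup>2) \<le> K * ip d v v"
    and K: "0 \<le> K" and N: "0 < N" "N \<le> 0.9 * real (size S)"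
    and \<delta>: "0.1 \<le> \<delta>" and s2: "0 \<le> s2"
    and mean: "K / N \<le> s2 * \<delta>\<^sup>2" and cov: "K / N + s2 \<le> s2 * \<delta>\<^sup>2 / 0.1"
  shows "is_stable d 0.1 \<delta> \<mu> s2 S"
  unfolding is_stable_def
proof (intro conjI allI impI)
  fix S' assume S': "S' \<subseteq># S \<and> (1 - 0.1) * real (size S) \<le> real (size S')"
  define p where "p = real (size S')"
  have p: "0 < p" "N \<le> p" using S' N by (auto simp: p_def)
  define c where "c = (\<lambda>(x :: nat \<Rightarrow> real) i. x i - \<mu> i)"
  have b: "(\<Sum>x\<in>#S'. (ip d v (c x))\<^sup>2) \<le> K * ip d v v" for v
  proof -
    have "(\<Sum>x\<in>#S'. (ip d v (c x))\<^sup>2) \<le> (\<Sum>x\<in>#S'. (ip d v (c x))\<^sup>2) + (\<Sum>x\<in>#S - S'. (ip d v (c x))\<^sup>2)"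
      by (simp add: sum_mset_power2_nonneg)
    also have "\<dots> = (\<Sum>x\<in>#S. (ip d v (c x))\<^sup>2)"
      using S' by (metis image_mset_union subset_mset.add_diff_inverse sum_mset.union)
    finally show ?thesis using bound[of v] by (simp add: c_def)
  qed
  have Kp: "K / p \<le> K / N" using p K N by (intro divide_left_mono) auto
  show "vec_norm d (\<lambda>i. emp_mean d S' i - \<mu> i) \<le> sqrt s2 * \<delta>"
  proof -
    define z where "z = (\<lambda>i. emp_mean d S' i - \<mu> i)"
    have zi: "z i = (\<Sum>x\<in>#S'. c x i) / p" if "i < d" for i
    proof -
      have "(\<Sum>x\<in>#S'. c x i) = (\<Sum>x\<in>#S'. x i) - p * \<mu> i"
        unfolding c_def p_def by (induction S') (auto simp: algebra_simps)
      then show ?thesis using that p by (simp add: z_def emp_mean_def p_def[symmetric] field_simps)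
    qed
    \<comment> \<open>The deviation is paired with itself, so that its squared norm is an average of
      inner products to which Cauchy-Schwarz applies.\<close>
    have "ip d z z = (\<Sum>x\<in>#S'. ip d z (c x) / p)"
    proof -
      have "ip d z z = (\<Sum>i<d. z i * ((\<Sum>x\<in>#S'. c x i) / p))"
        unfolding ip_def by (intro sum.cong) (auto simp: zi)
      also have "\<dots> = (\<Sum>i<d. \<Sum>x\<in>#S'. z i * c x i / p)"
        by (simp add: sum_mset_distrib_left sum_mset_divide ac_simps)
      also have "\<dots> = (\<Sum>x\<in>#S'. ip d z (c x) / p)"
        by (simp add: sum_sum_mset_swap ip_def sum_divide_distrib)
      finally show ?thesis .
    qed
    then have "(ip d z z)\<^sup>2 = (\<Sum>x\<in>#S'. ip d z (c x) * (1 / p))\<^sup>2" by simp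
    also have "\<dots> \<le> (\<Sum>x\<in>#S'. (ip d z (c x))\<^sup>2) * (\<Sum>x\<in>#S'. (1 / p)\<^sup>2)"
      by (rule Cauchy_Schwarz_sum_mset)
    also have "\<dots> = (\<Sum>x\<in>#S'. (ip d z (c x))\<^sup>2) / p"
      using p by (simp add: p_def[symmetric] power2_eq_square)
    also have "\<dots> \<le> K * ip d z z / p"
      using p b[of z] by (intro divide_right_mono) auto
    finally have "ip d z z * ip d z z \<le> (K / p) * ip d z z" by (simp add: power2_eq_square)
    then have "ip d z z \<le> K / p"
      by (rule le_of_mult_self_le) (use ip_self_nonneg[of d z] K p in auto)
    also have "\<dots> \<le> s2 * \<delta>\<^sup>2" using Kp mean by simp
    finally have "sqrt (ip d z z) \<le> sqrt (s2 * \<delta>\<^sup>2)" by simp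
    then show ?thesis using \<delta> by (simp add: vec_norm_ip z_def real_sqrt_mult)
  qed
  show "spectral_norm d (\<lambda>i j. emp_cov \<mu> S' i j - s2 * id_mat i j) \<le> s2 * \<delta>\<^sup>2 / 0.1"
  proof (rule spectral_norm_leI)
    fix x assume x: "vec_norm d x \<le> 1"
    define w where "w = mat_vec d (emp_cov \<mu> S') x"
    have eq: "vec_norm d (mat_vec d (\<lambda>i j. emp_cov \<mu> S' i j - s2 * id_mat i j) x)
        = vec_norm d (\<lambda>i. w i - s2 * x i)"
    proof -
      have "mat_vec d (\<lambda>i j. emp_cov \<mu> S' i j - s2 * id_mat i j) x i = w i - s2 * x i" if "i < d" for i
      proof -
        have "(\<Sum>j<d. id_mat i j * x j) = x i"
          using that by (simp add: id_mat_def if_distrib[where f="\<lambda>x. x * _"] cong: if_cong)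
        then have "(\<Sum>j<d. s2 * (id_mat i j * x j)) = s2 * x i" by (simp flip: sum_distrib_left)
        then show ?thesis
          by (simp add: mat_vec_def w_def left_diff_distrib sum_subtractf mult.assoc)
      qed
      then show ?thesis unfolding vec_norm_def by (intro L2_set_cong) auto
    qed
    have wi: "w i = (\<Sum>y\<in>#S'. c y i * ip d x (c y)) / p" for i
    proof -
      have "w i = (\<Sum>j<d. (\<Sum>y\<in>#S'. c y i * c y j) / p * x j)"
        by (simp add: w_def mat_vec_def emp_cov_def c_def p_def)
      also have "\<dots> = (\<Sum>j<d. \<Sum>y\<in>#S'. c y i * (x j * c y j)) / p"
        by (simp add: sum_divide_distrib sum_mset_distrib_left ac_simps)
      also have "\<dots> = (\<Sum>y\<in>#S'. c y i * ip d x (c y)) / p"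
        by (simp add: sum_sum_mset_swap ip_def sum_distrib_left)
      finally show ?thesis .
    qed
    \<comment> \<open>The same device with the two directions \<open>w\<close> and \<open>x\<close>;
      it bounds the norm of \<open>w\<close> without diagonalising the covariance.\<close>
    have "ip d w w = (\<Sum>i<d. w i * ((\<Sum>y\<in>#S'. c y i * ip d x (c y)) / p))"
      unfolding ip_def[of d w w] by (intro sum.cong) (auto simp: wi)
    also have "\<dots> = (\<Sum>i<d. \<Sum>y\<in>#S'. w i * c y i * ip d x (c y)) / p"
      by (simp add: sum_divide_distrib sum_mset_distrib_left ac_simps)
    also have "\<dots> = (\<Sum>y\<in>#S'. ip d w (c y) * ip d x (c y)) / p"
      by (simp add: sum_sum_mset_swap ip_def[of d w] sum_distrib_right)
    finally have "(p * ip d w w)\<^sup>2 = (\<Sum>y\<in>#S'. ip d w (c y) * ip d x (c y))\<^sup>2"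
      using p by simp
    also have "\<dots> \<le> (\<Sum>y\<in>#S'. (ip d w (c y))\<^sup>2) * (\<Sum>y\<in>#S'. (ip d x (c y))\<^sup>2)"
      by (rule Cauchy_Schwarz_sum_mset)
    also have "\<dots> \<le> (K * ip d w w) * (K * ip d x x)"
      by (intro mult_mono b mult_nonneg_nonneg K ip_self_nonneg sum_mset_power2_nonneg)
    also have "\<dots> \<le> (K * ip d w w) * (K * 1)"
      using x by (intro mult_left_mono mult_nonneg_nonneg K ip_self_nonneg)
        (auto simp: vec_norm_ip)
    finally have "ip d w w * ip d w w \<le> (K / p)\<^sup>2 * ip d w w"
      using p by (simp add: power2_eq_square field_simps)
    then have "ip d w w \<le> (K / p)\<^sup>2"
      by (rule le_of_mult_self_le) (auto simp: ip_self_nonneg)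
    then have w: "vec_norm d w \<le> K / p"
      using p K by (simp add: vec_norm_ip real_le_lsqrt)
    have "vec_norm d (\<lambda>i. w i - s2 * x i) \<le> vec_norm d w + s2 * vec_norm d x"
      using vec_norm_diff_le[of d w "\<lambda>i. s2 * x i"] s2 by (simp add: vec_norm_scale)
    also have "\<dots> \<le> K / N + s2 * 1"
      using w Kp x s2 by (intro add_mono mult_left_mono) auto
    also have "\<dots> \<le> s2 * \<delta>\<^sup>2 / 0.1" using cov by simp
    finally show "vec_norm d (mat_vec d (\<lambda>i j. emp_cov \<mu> S' i j - s2 * id_mat i j) x) \<le> s2 * \<delta>\<^sup>2 / 0.1"
      using eq by simp
  qed
qed (use \<delta> in auto)

section \<open>Trigonometric weights\<close>

lemma one_minus_cos_ge:
  fixes a :: real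
  assumes "\<bar>a\<bar> \<le> 1"
  shows "a\<^sup>2 / 4 \<le> 1 - cos a"
proof -
  have sin_ge: "x / 2 \<le> sin x" if x: "0 \<le> x" "x \<le> 1" for x :: real
  proof -
    have "sin 0 - 0 / 2 \<le> sin x - x / 2"
    proof (rule DERIV_nonneg_imp_nondecreasing[OF x(1)])
      fix y assume y: "0 \<le> y" "y \<le> x"
      \<comment> \<open>The interval from 0 to 1 lies below \<open>pi / 3\<close>, where the cosine
        is at least 1/2; this is where the bound on \<open>a\<close> enters.\<close>
      have "cos (pi / 3) \<le> cos y"
        using y x pi_gt3 by (intro cos_monotone_0_pi_le) auto
      then have "0 \<le> cos y - 1 / 2" by (simp add: cos_60)
      moreover have "DERIV (\<lambda>x. sin x - x / 2) y :> cos y - 1 / 2"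
        by (auto intro!: derivative_eq_intros)
      ultimately show "\<exists>l. DERIV (\<lambda>x. sin x - x / 2) y :> l \<and> 0 \<le> l" by blast
    qed
    then show ?thesis by simp
  qed
  have "1 - cos 0 - 0\<^sup>2 / 4 \<le> 1 - cos \<bar>a\<bar> - \<bar>a\<bar>\<^sup>2 / 4"
  proof (rule DERIV_nonneg_imp_nondecreasing[where f = "\<lambda>x. 1 - cos x - x\<^sup>2 / 4"])
    fix y assume y: "0 \<le> y" "y \<le> \<bar>a\<bar>"
    have "DERIV (\<lambda>x. 1 - cos x - x\<^sup>2 / 4) y :> sin y - y / 2"
      by (auto intro!: derivative_eq_intros)
    then show "\<exists>l. DERIV (\<lambda>x. 1 - cos x - x\<^sup>2 / 4) y :> l \<and> 0 \<le> l"
      using sin_ge[of y] y assms by auto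
  qed simp
  then show ?thesis by simp
qed

lemma one_minus_cos_le: "1 - cos a \<le> a\<^sup>2 / 2" for a :: real
proof -
  have "1 - cos a = 2 * (sin (a / 2))\<^sup>2"
    using cos_double_sin[of "a / 2"] by simp
  also have "\<dots> \<le> 2 * (a / 2)\<^sup>2"
    using abs_sin_x_le_abs_x[of "a / 2"] by (intro mult_left_mono) (auto simp: abs_le_square_iff[symmetric])
  finally show ?thesis by (simp add: power2_eq_square)
qed

text \<open>On the interval from 0 to 2 the convex exponential lies below its chord, whose slope is
  at most 4 because \<open>exp 2 \<le> 9\<close>. Boundedness of the exponent is what lets a finite
  second moment control an exponential moment.\<close>

lemma exp_one_minus_cos_le: "exp (1 - cos a) \<le> 1 + 2 * a\<^sup>2" for a :: real
proof -
  define y where "y = 1 - cos a"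
  have y: "0 \<le> y" "y \<le> 2" using cos_ge_minus_one[of a] cos_le_one[of a] unfolding y_def by linarith+
  have "exp ((1 - y / 2) *\<^sub>R 0 + (y / 2) *\<^sub>R 2) \<le> (1 - y / 2) * exp 0 + (y / 2) * exp (2::real)"
    using y by (intro convex_onD[OF exp_convex]) auto
  moreover have "exp (2::real) \<le> 9"
    using power_mono[OF exp_le, of 2] by (simp add: exp_double[symmetric] flip: exp_of_nat_mult)
  then have "(y / 2) * exp 2 \<le> (y / 2) * 9" using y by (intro mult_left_mono) auto
  ultimately have "exp y \<le> 1 + 4 * y" by simp
  also have "\<dots> \<le> 1 + 2 * a\<^sup>2" using one_minus_cos_le[of a] by (simp add: y_def)
  finally show ?thesis by (simp add: y_def)
qed

text \<open>In the application the lists of vectors have unbounded length, so the infimum is only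
  approached. If \<open>a\<close> is not itself within \<open>\<theta>\<close> of optimal, then
  every point that is within \<open>\<theta>\<close> of optimal lies below
  \<open>F a\<close>.\<close>

lemma ex_approx_minimizer:
  fixes F :: "'a \<Rightarrow> real"
  assumes "a \<in> A" and "\<And>u. u \<in> A \<Longrightarrow> c \<le> F u" and "0 < \<theta>"
  shows "\<exists>u\<in>A. F u \<le> F a \<and> (\<forall>u'\<in>A. F u \<le> F u' + \<theta>)"
proof (cases "\<forall>u'\<in>A. F a \<le> F u' + \<theta>")
  case True
  then show ?thesis using assms(1) by blast
next
  case False
  have bdd: "bdd_below (F ` A)" using assms(2) by (intro bdd_belowI2)
  obtain u where u: "u \<in> A" "F u < Inf (F ` A) + \<theta>"
    using cInf_lessD[of "F ` A" "Inf (F ` A) + \<theta>"] assms by auto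
  have *: "F u \<le> F u' + \<theta>" if "u' \<in> A" for u'
    using cINF_lower[OF bdd that] u by simp
  obtain u'' where "u'' \<in> A" "F u'' + \<theta> < F a" using False by auto
  with *[of u''] have "F u \<le> F a" by simp
  with u(1) * show ?thesis by blast
qed

text \<open>The characteristic function at \<open>y\<close> of the sum of the vectors in
  \<open>U\<close> with independent random signs, as \<open>sign_avg_cos\<close> makes
  precise.\<close>

definition cos_weight :: "nat \<Rightarrow> (nat \<Rightarrow> real) list \<Rightarrow> (nat \<Rightarrow> real) \<Rightarrow> real" where
  "cos_weight d U y = (\<Prod>u\<leftarrow>U. cos (ip d u y))"

text \<open>The vectors in \<open>U\<close> are kept so short that all cosines are nonnegative and comparable to quadratics.\<close>

lemma ex_cos_weights:
  fixes Y :: "'b \<Rightarrow> nat \<Rightarrow> real"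
  assumes "finite I" and \<Lambda>: "0 < \<Lambda>"
  shows "\<exists>U. (\<forall>b\<in>I. 0 \<le> cos_weight d U (Y b)) \<and>
    \<Lambda> * (\<Sum>u\<leftarrow>U. ip d u u) \<le> (\<Sum>b\<in>I. 1 - cos_weight d U (Y b)) \<and>
    (\<forall>v. (\<Sum>b\<in>I. cos_weight d U (Y b) * (ip d v (Y b))\<^sup>2) \<le> 8 * \<Lambda> * ip d v v)"
proof -
  \<comment> \<open>This length bound keeps every inner product with a \<open>Y b\<close> at most 1
    in absolute value, inside the range of \<open>one_minus_cos_ge\<close> and of nonnegative
    cosines.\<close>
  define \<eta> where "\<eta> = 1 / (1 + (\<Sum>b\<in>I. vec_norm d (Y b)))"
  have s0: "0 \<le> (\<Sum>b\<in>I. vec_norm d (Y b))" by (intro sum_nonneg vec_norm_nonneg)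
  have \<eta>: "0 < \<eta>" using s0 by (simp add: \<eta>_def)
  have small: "\<bar>ip d u (Y b)\<bar> \<le> 1" if "vec_norm d u \<le> \<eta>" "b \<in> I" for u b
  proof -
    have "\<bar>ip d u (Y b)\<bar> \<le> vec_norm d u * vec_norm d (Y b)" by (rule abs_ip_le)
    also have "\<dots> \<le> \<eta> * (1 + (\<Sum>b\<in>I. vec_norm d (Y b)))"
      using that \<eta> member_le_sum[of b I "\<lambda>b. vec_norm d (Y b)"] assms(1)
      by (intro mult_mono) (auto simp: vec_norm_nonneg)
    also have "\<dots> = 1" using s0 by (simp add: \<eta>_def)
    finally show ?thesis .
  qed
  define A where "A = {U. \<forall>u\<in>set U. vec_norm d u \<le> \<eta>}"
  define F where "F U = (\<Sum>b\<in>I. cos_weight d U (Y b)) + \<Lambda> * (\<Sum>u\<leftarrow>U. ip d u u)" for U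
  have w0: "0 \<le> cos_weight d U (Y b)" if "U \<in> A" "b \<in> I" for U b
    unfolding cos_weight_def
  proof (rule prod_list_nonneg)
    fix x assume "x \<in> set (map (\<lambda>u. cos (ip d u (Y b))) U)"
    then obtain u where u: "u \<in> set U" "x = cos (ip d u (Y b))" by auto
    have "\<bar>ip d u (Y b)\<bar> \<le> 1" using small that u by (auto simp: A_def)
    then show "0 \<le> x" unfolding u(2) using pi_gt3 by (intro cos_ge_zero) auto
  qed
  \<comment> \<open>The tolerance equals the penalty of one further vector of length
    \<open>\<eta>\<close>, so appending such a vector can lower the sum of weights by at most
    \<open>2 * \<Lambda> * \<eta>\<^sup>2\<close>. With the factor 1/4 of the cosine bound this is
    the origin of the 8.\<close>
  have "\<exists>U\<in>A. F U \<le> F [] \<and> (\<forall>U'\<in>A. F U \<le> F U' + \<Lambda> * \<eta>\<^sup>2)"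
  proof (rule ex_approx_minimizer)
    show "[] \<in> A" by (simp add: A_def)
    show "0 \<le> F U" if "U \<in> A" for U
      using w0[OF that] \<Lambda> unfolding F_def
      by (intro add_nonneg_nonneg sum_nonneg mult_nonneg_nonneg sum_list_nonneg) (auto simp: ip_self_nonneg)
    show "0 < \<Lambda> * \<eta>\<^sup>2" using \<Lambda> \<eta> by simp
  qed
  then obtain U where U: "U \<in> A" "F U \<le> F []" and min: "\<And>U'. U' \<in> A \<Longrightarrow> F U \<le> F U' + \<Lambda> * \<eta>\<^sup>2"
    by blast
  have "(\<Sum>b\<in>I. cos_weight d U (Y b) * (ip d v (Y b))\<^sup>2) \<le> 8 * \<Lambda> * ip d v v" for v
  proof (cases "vec_norm d v = 0")
    case True
    have "ip d v (Y b) = 0" for b using abs_ip_le[of d v "Y b"] True by simp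
    then show ?thesis using \<Lambda> by (simp add: ip_self_nonneg)
  next
    case False
    define c where "c = \<eta> / vec_norm d v"
    have v: "0 < vec_norm d v" using False vec_norm_nonneg[of d v] by simp
    have c: "0 < c" using v \<eta> by (simp add: c_def)
    define u where "u = (\<lambda>i. c * v i)"
    have nu: "vec_norm d u = \<eta>" unfolding u_def vec_norm_scale using v \<eta> by (simp add: c_def)
    have iu: "ip d u u = \<eta>\<^sup>2" using nu vec_norm_sq by metis
    have "F U \<le> F (u # U) + \<Lambda> * \<eta>\<^sup>2" using U nu by (intro min) (auto simp: A_def)
    then have "(\<Sum>b\<in>I. cos_weight d U (Y b) * (1 - cos (ip d u (Y b)))) \<le> 2 * \<Lambda> * \<eta>\<^sup>2"
      by (simp add: F_def cos_weight_def iu algebra_simps sum_subtractf)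
    moreover have "(\<Sum>b\<in>I. cos_weight d U (Y b) * ((ip d u (Y b))\<^sup>2 / 4))
        \<le> (\<Sum>b\<in>I. cos_weight d U (Y b) * (1 - cos (ip d u (Y b))))"
      using U nu small w0 by (intro sum_mono mult_left_mono one_minus_cos_ge) auto
    moreover have "(\<Sum>b\<in>I. cos_weight d U (Y b) * ((ip d u (Y b))\<^sup>2 / 4))
        = c\<^sup>2 / 4 * (\<Sum>b\<in>I. cos_weight d U (Y b) * (ip d v (Y b))\<^sup>2)"
      by (simp add: u_def ip_scale_left sum_distrib_left power_mult_distrib algebra_simps)
    moreover have "\<eta>\<^sup>2 = c\<^sup>2 * ip d v v" using v by (simp add: c_def power_divide vec_norm_sq flip: vec_norm_sq)
    ultimately have "c\<^sup>2 * (\<Sum>b\<in>I. cos_weight d U (Y b) * (ip d v (Y b))\<^sup>2) \<le> c\<^sup>2 * (8 * \<Lambda> * ip d v v)"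
      by (simp add: algebra_simps)
    then show ?thesis using c by simp
  qed
  \<comment> \<open>For the empty list all weights equal 1 and the penalty is 0, so this is
    \<open>F U \<le> F []\<close> rearranged.\<close>
  moreover have "\<Lambda> * (\<Sum>u\<leftarrow>U. ip d u u) \<le> (\<Sum>b\<in>I. 1 - cos_weight d U (Y b))"
    using U(2) by (simp add: F_def cos_weight_def sum_subtractf)
  ultimately show ?thesis using w0[OF U(1)] by blast
qed

section \<open>Uniform averages over the signs of a list of vectors\<close>

fun sign_avg :: "(nat \<Rightarrow> real) list \<Rightarrow> ((nat \<Rightarrow> real) \<Rightarrow> real) \<Rightarrow> real" where
  "sign_avg [] f = f (\<lambda>_. 0)"
| "sign_avg (u # U) f = (sign_avg U (\<lambda>v. f (\<lambda>i. u i + v i)) + sign_avg U (\<lambda>v. f (\<lambda>i. v i - u i))) / 2"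

lemma sign_avg_mono: "(\<And>v. f v \<le> g v) \<Longrightarrow> sign_avg U f \<le> sign_avg U g"
  by (induction U arbitrary: f g) (auto intro!: divide_right_mono add_mono)

lemma sign_avg_add: "sign_avg U (\<lambda>v. f v + g v) = sign_avg U f + sign_avg U g"
  by (induction U arbitrary: f g) (auto simp: field_simps)

lemma sign_avg_scale: "sign_avg U (\<lambda>v. c * f v) = c * sign_avg U f"
  by (induction U arbitrary: f) (auto simp: field_simps)

lemma sign_avg_const: "sign_avg U (\<lambda>v. c) = c"
  by (induction U) auto

lemma sign_avg_sum: "sign_avg U (\<lambda>v. \<Sum>b\<in>I. f b v) = (\<Sum>b\<in>I. sign_avg U (f b))"
  by (induction I rule: infinite_finite_induct) (auto simp: sign_avg_const sign_avg_add)

text \<open>The phase \<open>b\<close> makes the induction go through: the two signs of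
  \<open>u\<close> combine by \<open>cos (b + x) + cos (b - x) = 2 * cos x * cos b\<close>. With the
  phase \<open>- (pi / 2)\<close> the same formula shows that sines average to zero.\<close>

lemma sign_avg_cos: "sign_avg U (\<lambda>v. cos (ip d v y + b)) = cos_weight d U y * cos b"
proof (induction U arbitrary: b)
  case Nil
  then show ?case by (simp add: ip_def cos_weight_def)
next
  case (Cons u U)
  have "sign_avg U (\<lambda>v. cos (ip d u y + ip d v y + b)) = cos_weight d U y * cos (ip d u y + b)"
    using Cons[of "ip d u y + b"] by (simp add: ac_simps)
  moreover have "sign_avg U (\<lambda>v. cos (ip d v y - ip d u y + b)) = cos_weight d U y * cos (b - ip d u y)"
    using Cons[of "b - ip d u y"] by (simp add: algebra_simps)
  ultimately have "sign_avg (u # U) (\<lambda>v. cos (ip d v y + b)) =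
      (cos_weight d U y * cos (ip d u y + b) + cos_weight d U y * cos (b - ip d u y)) / 2"
    by (simp add: ip_add_left ip_diff_left)
  then show ?case
    by (simp add: cos_add cos_diff cos_weight_def algebra_simps)
qed

lemma quad_parallelogram:
  "quad d A (\<lambda>i. x i + y i) + quad d A (\<lambda>i. y i - x i) = 2 * quad d A x + 2 * quad d A y"
  by (simp add: quad_def sum_distrib_left sum.distrib[symmetric] algebra_simps)

text \<open>The offset \<open>c\<close> absorbs the vectors already processed, and the parallelogram
  identity cancels the cross terms.\<close>

lemma sign_avg_quad:
  "sign_avg U (\<lambda>v. quad d A (\<lambda>i. v i + c i)) = (\<Sum>u\<leftarrow>U. quad d A u) + quad d A c"
proof (induction U arbitrary: c)
  case Nil
  then show ?case by simp
next
  case (Cons u U)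
  have "sign_avg U (\<lambda>v. quad d A (\<lambda>i. u i + v i + c i)) = (\<Sum>u\<leftarrow>U. quad d A u) + quad d A (\<lambda>i. u i + c i)"
    using Cons[of "\<lambda>i. u i + c i"] by (simp add: algebra_simps)
  moreover have "sign_avg U (\<lambda>v. quad d A (\<lambda>i. v i - u i + c i)) = (\<Sum>u\<leftarrow>U. quad d A u) + quad d A (\<lambda>i. c i - u i)"
    using Cons[of "\<lambda>i. c i - u i"] by (simp add: algebra_simps)
  ultimately show ?case using quad_parallelogram[of d A u c] by simp
qed

lemma sign_avg_quad0: "sign_avg U (quad d A) = (\<Sum>u\<leftarrow>U. quad d A u)"
  using sign_avg_quad[of U d A "\<lambda>_. 0"] by (simp add: quad_def[of d A "\<lambda>_. 0"])

lemma ip_eq_quad: "ip d v v = quad d id_mat v"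
  by (simp add: ip_def quad_def id_mat_def if_distrib[where f="\<lambda>x. x * _"] cong: if_cong)

section \<open>A PAC-Bayesian bound\<close>

definition gauss :: "nat \<Rightarrow> real \<Rightarrow> (nat \<Rightarrow> real) measure" where
  "gauss d s = (\<Pi>\<^sub>M i\<in>{..<d}. density lborel (normal_density 0 s))"

lemma sets_gauss [measurable_cong]: "sets (gauss d s) = sets (\<Pi>\<^sub>M i\<in>{..<d}. borel)"
  unfolding gauss_def by (intro sets_PiM_cong) auto

lemma prob_space_gauss: "0 < s \<Longrightarrow> prob_space (gauss d s)"
  unfolding gauss_def by (intro prob_space_PiM prob_space_normal_density)

lemma iid_coordinate_mean:
  fixes g :: "'a \<Rightarrow> real"
  assumes N: "prob_space N" and i: "i \<in> J" and g: "integrable N g"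
  shows "integrable (PiM J (\<lambda>_. N)) (\<lambda>\<omega>. g (\<omega> i))"
    and "(\<integral>\<omega>. g (\<omega> i) \<partial>PiM J (\<lambda>_. N)) = (\<integral>x. g x \<partial>N)"
proof -
  have eq: "distr (PiM J (\<lambda>_. N)) N (\<lambda>\<omega>. \<omega> i) = N"
    using i by (rule distr_PiM_component[OF N])
  show "integrable (PiM J (\<lambda>_. N)) (\<lambda>\<omega>. g (\<omega> i))"
    using g i by (subst integrable_distr_eq[where g = "\<lambda>\<omega>. \<omega> i" and N = N, symmetric]) (auto simp: eq)
  show "(\<integral>\<omega>. g (\<omega> i) \<partial>PiM J (\<lambda>_. N)) = (\<integral>x. g x \<partial>N)"
    using g i by (subst integral_distr[where g = "\<lambda>\<omega>. \<omega> i" and N = N, symmetric]) (auto simp: eq)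
qed

text \<open>The factors \<open>f l\<close> extend the integrand by ones to a product over all
  coordinates, so the diagonal and off-diagonal cases share one product formula. It serves both the
  Gaussian coordinates and the sample points.\<close>

lemma iid_coordinates_product:
  fixes g :: "'a \<Rightarrow> real"
  assumes N: "prob_space N" and J: "finite J" "i \<in> J" "j \<in> J"
    and g: "integrable N g" and g2: "integrable N (\<lambda>x. (g x)\<^sup>2)" and g0: "(\<integral>x. g x \<partial>N) = 0"
  shows "integrable (PiM J (\<lambda>_. N)) (\<lambda>\<omega>. g (\<omega> i) * g (\<omega> j))"
    and "(\<integral>\<omega>. g (\<omega> i) * g (\<omega> j) \<partial>PiM J (\<lambda>_. N)) = (if i = j then \<integral>x. (g x)\<^sup>2 \<partial>N else 0)"
proof -
  interpret N: prob_space N by (rule N)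
  interpret product_sigma_finite "\<lambda>_::'b. N" by standard
  define f where "f l x = (if l = i then g x else 1) * (if l = j then g x else 1)" for l x
  have f: "integrable N (f l)" for l
    using g g2 by (cases "l = i"; cases "l = j") (auto simp: f_def[abs_def] power2_eq_square)
  have eq: "(\<lambda>\<omega>. \<Prod>l\<in>J. f l (\<omega> l)) = (\<lambda>\<omega>. g (\<omega> i) * g (\<omega> j))"
    using J by (auto simp: f_def prod.delta prod.distrib)
  show "integrable (PiM J (\<lambda>_. N)) (\<lambda>\<omega>. g (\<omega> i) * g (\<omega> j))"
    using product_integrable_prod[of J f] f J by (simp add: eq)
  have prod: "(\<integral>\<omega>. g (\<omega> i) * g (\<omega> j) \<partial>PiM J (\<lambda>_. N)) = (\<Prod>l\<in>J. \<integral>x. f l x \<partial>N)"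
    using product_integral_prod[of J f] f J by (simp add: eq)
  show "(\<integral>\<omega>. g (\<omega> i) * g (\<omega> j) \<partial>PiM J (\<lambda>_. N)) = (if i = j then \<integral>x. (g x)\<^sup>2 \<partial>N else 0)"
  proof (cases "i = j")
    case True
    have "(\<integral>x. f l x \<partial>N) = (if l = i then \<integral>x. (g x)\<^sup>2 \<partial>N else 1)" for l
      using True N.prob_space by (auto simp: f_def[abs_def] power2_eq_square)
    then show ?thesis unfolding prod using J True by simp
  next
    case False
    then have "(\<integral>x. f i x \<partial>N) = 0" using g0 by (simp add: f_def[abs_def])
    then show ?thesis unfolding prod using J False by (auto intro!: prod_zero)
  qed
qed

lemma normal_moments:
  assumes s: "0 < s"
  shows "integrable (density lborel (normal_density 0 s)) (\<lambda>x. x ^ p)"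
    and "(\<integral>x. x \<partial>density lborel (normal_density 0 s)) = 0"
    and "(\<integral>x. x ^ 2 \<partial>density lborel (normal_density 0 s)) = s\<^sup>2"
proof -
  show "integrable (density lborel (normal_density 0 s)) (\<lambda>x. x ^ p)"
    using integrable_normal_moment[of s 0 p] s by (subst integrable_density) auto
  show "(\<integral>x. x \<partial>density lborel (normal_density 0 s)) = 0"
    using integral_normal_moment_nz_1[of s 0] s by (subst integral_density) auto
  show "(\<integral>x. x ^ 2 \<partial>density lborel (normal_density 0 s)) = s\<^sup>2"
    using integral_normal_moment_even[of s 0 1] s by (subst integral_density) (auto simp: fact_numeral)
qed

lemma gauss_mean:
  assumes s: "0 < s" and i: "i < d"
  shows "integrable (gauss d s) (\<lambda>\<theta>. \<theta> i)" and "(\<integral>\<theta>. \<theta> i \<partial>gauss d s) = 0"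
  using iid_coordinate_mean[OF prob_space_normal_density[OF s], of i "{..<d}" _ "\<lambda>x. x"]
    normal_moments(1)[OF s, of 1] normal_moments(2)[OF s] i
  by (auto simp: gauss_def)

lemma gauss_cov:
  assumes s: "0 < s" and i: "i < d" and j: "j < d"
  shows "integrable (gauss d s) (\<lambda>\<theta>. \<theta> i * \<theta> j)"
    and "(\<integral>\<theta>. \<theta> i * \<theta> j \<partial>gauss d s) = (if i = j then s\<^sup>2 else 0)"
  using iid_coordinates_product[OF prob_space_normal_density[OF s], of "{..<d}" i j _ "\<lambda>x. x"]
    normal_moments(1)[OF s, of 1] normal_moments(1)[OF s, of 2] normal_moments(2,3)[OF s] i j
  by (auto simp: gauss_def)

section \<open>Shifts of the Gaussian and their densities\<close>

lemma normal_density_shift: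
  assumes "0 < s"
  shows "normal_density 0 s x * exp (- (x * v / s\<^sup>2) - v\<^sup>2 / (2 * s\<^sup>2)) = normal_density 0 s (x + v)"
proof -
  have "- (x\<^sup>2 / (2 * s\<^sup>2)) + (- (x * v / s\<^sup>2) - v\<^sup>2 / (2 * s\<^sup>2)) = - ((x + v)\<^sup>2 / (2 * s\<^sup>2))"
    using assms by (simp add: field_simps power2_eq_square)
  then show ?thesis unfolding normal_density_def by (simp add: exp_add[symmetric] algebra_simps)
qed

lemma nn_integral_normal_shift:
  assumes s: "0 < s" and [measurable]: "A \<in> sets borel"
  shows "(\<integral>\<^sup>+x. ennreal (exp (- (x * v / s\<^sup>2) - v\<^sup>2 / (2 * s\<^sup>2))) * indicator A (x + v)
      \<partial>density lborel (normal_density 0 s)) = emeasure (density lborel (normal_density 0 s)) A"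
proof -
  have "(\<integral>\<^sup>+x. ennreal (exp (- (x * v / s\<^sup>2) - v\<^sup>2 / (2 * s\<^sup>2))) * indicator A (x + v)
      \<partial>density lborel (normal_density 0 s)) =
      (\<integral>\<^sup>+x. ennreal (normal_density 0 s (v + x)) * indicator A (v + x) \<partial>lborel)"
    by (subst nn_integral_density)
      (auto simp: mult.assoc[symmetric] ennreal_mult[symmetric] normal_density_shift[OF s] add.commute)
  also have "\<dots> = (\<integral>\<^sup>+x. ennreal (normal_density 0 s x) * indicator A x \<partial>distr lborel borel ((+) v))"
    by (subst nn_integral_distr) auto
  also have "\<dots> = emeasure (density lborel (normal_density 0 s)) A"
    by (simp add: lborel_distr_plus emeasure_density)
  finally show ?thesis .
qed

text \<open>Restricted to \<open>{..<d}\<close>, since the points of \<open>gauss d s\<close> are extensional.\<close>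

definition shift :: "nat \<Rightarrow> (nat \<Rightarrow> real) \<Rightarrow> (nat \<Rightarrow> real) \<Rightarrow> nat \<Rightarrow> real" where
  "shift d v \<theta> = (\<lambda>i\<in>{..<d}. \<theta> i + v i)"

lemma measurable_shift [measurable]: "shift d v \<in> gauss d s \<rightarrow>\<^sub>M gauss d s"
  unfolding shift_def[abs_def] by measurable

lemma measurable_ip [measurable]: "(\<lambda>\<theta>. ip d \<theta> y) \<in> borel_measurable (gauss d s)"
  unfolding ip_def by measurable

text \<open>The Cameron-Martin formula in finite dimension: the exponential weight is the density,
  relative to \<open>gauss d s\<close>, of the Gaussian centred at \<open>-v\<close>, which
  \<open>shift d v\<close> moves back to the origin. Weight and boxes factor over the coordinates,
  where completing the square and translation invariance of Lebesgue measure apply.\<close>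

lemma gauss_shift:
  assumes s: "0 < s"
  shows "distr (density (gauss d s) (\<lambda>\<theta>. ennreal (exp (- (ip d \<theta> v / s\<^sup>2) - ip d v v / (2 * s\<^sup>2)))))
    (gauss d s) (shift d v) = gauss d s" (is "distr (density _ ?D) _ _ = _")
proof -
  let ?N = "density lborel (normal_density 0 s)"
  interpret N: prob_space ?N
    using s by (rule prob_space_normal_density)
  interpret product_sigma_finite "\<lambda>_::nat. ?N"
    by standard
  let ?e = "\<lambda>i x. ennreal (exp (- (x * v i / s\<^sup>2) - (v i)\<^sup>2 / (2 * s\<^sup>2)))"
  have D: "?D \<theta> = (\<Prod>i<d. ?e i (\<theta> i))" for \<theta>
  proof -
    have "exp (- (ip d \<theta> v / s\<^sup>2) - ip d v v / (2 * s\<^sup>2)) =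
        (\<Prod>i<d. exp (- (\<theta> i * v i / s\<^sup>2) - (v i)\<^sup>2 / (2 * s\<^sup>2)))"
      by (simp add: ip_def exp_sum[symmetric] sum_subtractf sum_negf sum_divide_distrib power2_eq_square)
    then show ?thesis by (simp add: prod_ennreal)
  qed
  have "distr (density (gauss d s) ?D) (gauss d s) (shift d v) = PiM {..<d} (\<lambda>_. ?N)"
  proof (rule PiM_eqI)
    show "sets (distr (density (gauss d s) ?D) (gauss d s) (shift d v)) = sets (PiM {..<d} (\<lambda>_. ?N))"
      by (simp add: gauss_def)
  next
    fix A :: "nat \<Rightarrow> real set" assume A: "\<And>i. i \<in> {..<d} \<Longrightarrow> A i \<in> sets ?N"
    then have A': "A i \<in> sets borel" if "i < d" for i using that by simp
    have box: "Pi\<^sub>E {..<d} A \<in> sets (gauss d s)" unfolding gauss_def using A by (intro sets_PiM_I_finite) auto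
    have "emeasure (distr (density (gauss d s) ?D) (gauss d s) (shift d v)) (Pi\<^sub>E {..<d} A)
        = (\<integral>\<^sup>+\<theta>. indicator (Pi\<^sub>E {..<d} A) \<theta> \<partial>distr (density (gauss d s) ?D) (gauss d s) (shift d v))"
      using box by simp
    also have "\<dots> = (\<integral>\<^sup>+\<theta>. ?D \<theta> * indicator (Pi\<^sub>E {..<d} A) (shift d v \<theta>) \<partial>gauss d s)"
      using box by (subst nn_integral_distr, simp, simp, subst nn_integral_density) auto
    also have "\<dots> = (\<integral>\<^sup>+\<theta>. (\<Prod>i<d. ?e i (\<theta> i) * indicator (A i) (\<theta> i + v i)) \<partial>gauss d s)"
    proof (rule nn_integral_cong)
      fix \<theta> :: "nat \<Rightarrow> real"
      have "indicator (Pi\<^sub>E {..<d} A) (shift d v \<theta>) = (\<Prod>i<d. indicator (A i) (\<theta> i + v i) :: ennreal)"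
      proof (cases "\<forall>i<d. \<theta> i + v i \<in> A i")
        case True
        then show ?thesis by (auto simp: shift_def indicator_def PiE_iff)
      next
        case False
        then obtain i where "i < d" "\<theta> i + v i \<notin> A i" by auto
        then have "(\<Prod>i<d. indicator (A i) (\<theta> i + v i) :: ennreal) = 0"
          by (intro prod_zero) (auto intro!: bexI[of _ i])
        moreover have "shift d v \<theta> \<notin> Pi\<^sub>E {..<d} A"
          using \<open>i < d\<close> \<open>\<theta> i + v i \<notin> A i\<close> by (auto simp: shift_def PiE_iff)
        ultimately show ?thesis by simp
      qed
      then show "?D \<theta> * indicator (Pi\<^sub>E {..<d} A) (shift d v \<theta>) =
          (\<Prod>i<d. ?e i (\<theta> i) * indicator (A i) (\<theta> i + v i))"
        by (simp add: D prod.distrib)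
    qed
    also have "\<dots> = (\<Prod>i<d. \<integral>\<^sup>+x. ?e i x * indicator (A i) (x + v i) \<partial>?N)"
      unfolding gauss_def
      by (subst product_nn_integral_prod) (use A' in \<open>auto intro!: borel_measurable_times_ennreal borel_measurable_indicator'\<close>)
    also have "\<dots> = (\<Prod>i<d. emeasure ?N (A i))"
      using A' nn_integral_normal_shift[OF s] by (intro prod.cong) auto
    finally show "emeasure (distr (density (gauss d s) ?D) (gauss d s) (shift d v)) (Pi\<^sub>E {..<d} A)
      = (\<Prod>i<d. emeasure ?N (A i))" .
  qed simp
  then show ?thesis by (simp add: gauss_def)
qed

lemma nn_integral_gauss_shift:
  assumes s: "0 < s" and [measurable]: "g \<in> borel_measurable (gauss d s)"
  shows "(\<integral>\<^sup>+\<theta>. ennreal (exp (- (ip d \<theta> v / s\<^sup>2) - ip d v v / (2 * s\<^sup>2))) * g (shift d v \<theta>) \<partial>gauss d s)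
    = (\<integral>\<^sup>+\<theta>. g \<theta> \<partial>gauss d s)"
  by (subst (2) gauss_shift[OF s, of d v, symmetric])
    (subst nn_integral_distr, simp, simp, subst nn_integral_density, auto)

text \<open>Donsker and Varadhan's inequality for a shift; \<open>1 + x \<le> exp x\<close> replaces Jensen's inequality.\<close>

lemma gauss_change_of_measure:
  assumes s: "0 < s" and [measurable]: "h \<in> borel_measurable (gauss d s)"
    and exp_h: "(\<integral>\<^sup>+\<theta>. ennreal (exp (h \<theta>)) \<partial>gauss d s) \<le> ennreal (exp t)"
    and int: "integrable (gauss d s) (\<lambda>\<theta>. h (shift d v \<theta>))"
  shows "(\<integral>\<theta>. h (shift d v \<theta>) \<partial>gauss d s) \<le> ip d v v / (2 * s\<^sup>2) + t"
proof -
  interpret prob_space "gauss d s" using s by (rule prob_space_gauss)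
  \<comment> \<open>The logarithm of the density of the Gaussian centred at \<open>-v\<close>. Its
    mean under the prior is minus the relative entropy,
    \<open>- (ip d v v / (2 * s\<^sup>2))\<close>.\<close>
  define E where "E \<theta> = - (ip d \<theta> v / s\<^sup>2) - ip d v v / (2 * s\<^sup>2)" for \<theta>
  define X where "X \<theta> = E \<theta> + h (shift d v \<theta>) - t" for \<theta>
  have [measurable]: "X \<in> borel_measurable (gauss d s)" unfolding X_def[abs_def] E_def by measurable
  have "(\<integral>\<^sup>+\<theta>. ennreal (exp (X \<theta>)) \<partial>gauss d s) =
      (\<integral>\<^sup>+\<theta>. ennreal (exp (- t)) * (ennreal (exp (E \<theta>)) * ennreal (exp (h (shift d v \<theta>)))) \<partial>gauss d s)"
    by (intro nn_integral_cong) (simp add: X_def ennreal_mult[symmetric] exp_add[symmetric])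
  also have "\<dots> = ennreal (exp (- t)) * (\<integral>\<^sup>+\<theta>. ennreal (exp (h \<theta>)) \<partial>gauss d s)"
    by (subst nn_integral_cmult)
      (auto simp: E_def nn_integral_gauss_shift[OF s, where g = "\<lambda>\<theta>. ennreal (exp (h \<theta>))"])
  also have "\<dots> \<le> ennreal (exp (- t)) * ennreal (exp t)"
    by (intro mult_left_mono exp_h) auto
  also have "\<dots> = 1" by (simp add: ennreal_mult[symmetric] exp_minus)
  finally have le1: "(\<integral>\<^sup>+\<theta>. ennreal (exp (X \<theta>)) \<partial>gauss d s) \<le> 1" .
  have int_exp: "integrable (gauss d s) (\<lambda>\<theta>. exp (X \<theta>))"
    using le1 by (intro integrableI_nonneg) (auto simp: less_top[symmetric] top_unique)
  have int_ip: "integrable (gauss d s) (\<lambda>\<theta>. ip d \<theta> v)"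
    unfolding ip_def using gauss_mean(1)[OF s] by (intro Bochner_Integration.integrable_sum) auto
  have ip0: "(\<integral>\<theta>. ip d \<theta> v \<partial>gauss d s) = 0"
    unfolding ip_def using gauss_mean[OF s] by (subst Bochner_Integration.integral_sum) auto
  have int_X: "integrable (gauss d s) X"
    unfolding X_def[abs_def] E_def using int int_ip by auto
  have "(\<integral>\<theta>. 1 + X \<theta> \<partial>gauss d s) \<le> (\<integral>\<theta>. exp (X \<theta>) \<partial>gauss d s)"
    using int_exp int_X by (intro integral_mono) auto
  also have "\<dots> \<le> 1"
    using le1 by (subst integral_eq_nn_integral) (auto intro!: enn2real_leI)
  also have "(\<integral>\<theta>. 1 + X \<theta> \<partial>gauss d s) = 1 + (\<integral>\<theta>. h (shift d v \<theta>) \<partial>gauss d s) - ip d v v / (2 * s\<^sup>2) - t"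
    unfolding X_def E_def using int int_ip ip0 by (simp add: prob_space)
  finally show ?thesis by simp
qed

section \<open>The shifted exponent and the bound on the weights\<close>

lemma ip_shift: "ip d (shift d v \<theta>) y = ip d \<theta> y + ip d v y"
  unfolding ip_def shift_def by (simp add: sum.distrib algebra_simps)

text \<open>The linear terms average to zero and the products of coordinates leave
  \<open>s\<^sup>2\<close> on the diagonal. This trace is how the effective rank enters the final
  bound.\<close>

lemma gauss_quad_shift:
  assumes s: "0 < s"
  shows "integrable (gauss d s) (\<lambda>\<theta>. quad d A (shift d v \<theta>))"
    and "(\<integral>\<theta>. quad d A (shift d v \<theta>) \<partial>gauss d s) = quad d A v + s\<^sup>2 * mat_trace d A"
proof -
  interpret prob_space "gauss d s" using s by (rule prob_space_gauss)
  have eq: "quad d A (shift d v \<theta>) = (\<Sum>i<d. \<Sum>j<d. A i j * (\<theta> i * \<theta> j + \<theta> i * v j + v i * \<theta> j + v i * v j))" for \<theta>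
    unfolding quad_def shift_def by (intro sum.cong) (auto simp: algebra_simps)
  have int: "integrable (gauss d s) (\<lambda>\<theta>. A i j * (\<theta> i * \<theta> j + \<theta> i * v j + v i * \<theta> j + v i * v j))"
    if "i < d" "j < d" for i j
    using gauss_mean(1)[OF s] gauss_cov(1)[OF s] that by auto
  have val: "(\<integral>\<theta>. A i j * (\<theta> i * \<theta> j + \<theta> i * v j + v i * \<theta> j + v i * v j) \<partial>gauss d s)
      = A i j * (v i * v j) + s\<^sup>2 * (if i = j then A i j else 0)"
    if "i < d" "j < d" for i j
  proof -
    have "(\<integral>\<theta>. A i j * (\<theta> i * \<theta> j + \<theta> i * v j + v i * \<theta> j + v i * v j) \<partial>gauss d s)
        = A i j * ((\<integral>\<theta>. \<theta> i * \<theta> j \<partial>gauss d s) + (\<integral>\<theta>. \<theta> i \<partial>gauss d s) * v j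
          + v i * (\<integral>\<theta>. \<theta> j \<partial>gauss d s) + v i * v j)"
      using gauss_mean(1)[OF s] gauss_cov(1)[OF s] that by (simp add: prob_space)
    then show ?thesis
      using gauss_mean(2)[OF s] gauss_cov(2)[OF s] that by (simp add: algebra_simps)
  qed
  show "integrable (gauss d s) (\<lambda>\<theta>. quad d A (shift d v \<theta>))"
    unfolding eq using int by (intro Bochner_Integration.integrable_sum) auto
  let ?q = "\<lambda>i j \<theta>. A i j * (\<theta> i * \<theta> j + \<theta> i * v j + v i * \<theta> j + v i * v j)"
  have "(\<integral>\<theta>. quad d A (shift d v \<theta>) \<partial>gauss d s) = (\<Sum>i<d. \<integral>\<theta>. (\<Sum>j<d. ?q i j \<theta>) \<partial>gauss d s)"
    unfolding eq using int by (intro Bochner_Integration.integral_sum Bochner_Integration.integrable_sum) auto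
  also have "\<dots> = (\<Sum>i<d. \<Sum>j<d. \<integral>\<theta>. ?q i j \<theta> \<partial>gauss d s)"
    using int by (intro sum.cong refl Bochner_Integration.integral_sum) auto
  also have "\<dots> = (\<Sum>i<d. \<Sum>j<d. A i j * (v i * v j) + s\<^sup>2 * (if i = j then A i j else 0))"
    by (intro sum.cong refl val) auto
  also have "\<dots> = quad d A v + s\<^sup>2 * mat_trace d A"
    by (simp add: quad_def mat_trace_def sum.distrib sum_distrib_left[symmetric])
  finally show "(\<integral>\<theta>. quad d A (shift d v \<theta>) \<partial>gauss d s) = quad d A v + s\<^sup>2 * mat_trace d A" .
qed

text \<open>The quadratic term is a compensator: with \<open>A\<close> the covariance and
  \<open>c\<close> as in \<open>block_mgf_le_1\<close>, the exponential has mean at most 1 over the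
  sample for each fixed \<open>\<theta>\<close>.\<close>

definition exponent ::
  "nat \<Rightarrow> real \<Rightarrow> (nat \<Rightarrow> nat \<Rightarrow> real) \<Rightarrow> 'b set \<Rightarrow> ('b \<Rightarrow> nat \<Rightarrow> real) \<Rightarrow> (nat \<Rightarrow> real) \<Rightarrow> real" where
  "exponent d c A I Y \<theta> = (\<Sum>b\<in>I. 1 - cos (ip d \<theta> (Y b))) - c * quad d A \<theta>"

lemma measurable_quad [measurable]: "quad d A \<in> borel_measurable (gauss d s)"
  unfolding quad_def[abs_def] by measurable

lemma measurable_exponent [measurable]: "exponent d c A I Y \<in> borel_measurable (gauss d s)"
  unfolding exponent_def[abs_def] by measurable

text \<open>\<open>gauss_change_of_measure\<close> bounds Gaussian-smoothed cosines for each shift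
  \<open>v\<close>, and averaging over the signed sums of \<open>U\<close> produces the weights. The
  hypothesis \<open>exp_h\<close> does not mention \<open>v\<close>, so \<open>U\<close> may be
  chosen depending on \<open>Y\<close>.\<close>

lemma pac_bayes_cos:
  assumes s: "0 < s" and I: "finite I"
    and exp_h: "(\<integral>\<^sup>+\<theta>. ennreal (exp (exponent d c A I Y \<theta>)) \<partial>gauss d s) \<le> ennreal (exp t)"
    and w: "\<And>b. b \<in> I \<Longrightarrow> 0 \<le> cos_weight d U (Y b)"
  shows "(\<Sum>b\<in>I. 1 - cos_weight d U (Y b)) \<le>
    c * ((\<Sum>u\<leftarrow>U. quad d A u) + s\<^sup>2 * mat_trace d A) + (\<Sum>u\<leftarrow>U. ip d u u) / (2 * s\<^sup>2) + t"
proof -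
  interpret prob_space "gauss d s" using s by (rule prob_space_gauss)
  define C where "C b = (\<integral>\<theta>. cos (ip d \<theta> (Y b)) \<partial>gauss d s)" for b
  define D where "D b = (\<integral>\<theta>. sin (ip d \<theta> (Y b)) \<partial>gauss d s)" for b
  have int_cos: "integrable (gauss d s) (\<lambda>\<theta>. cos (ip d \<theta> (Y b)))"
    and int_sin: "integrable (gauss d s) (\<lambda>\<theta>. sin (ip d \<theta> (Y b)))" for b
    by (auto intro!: integrable_const_bound[of _ 1])
  have C: "C b \<le> 1" for b
    using integral_mono[OF int_cos[of b], of "\<lambda>_. 1"] by (simp add: C_def prob_space)
  \<comment> \<open>The sine is written as a cosine with phase \<open>- (pi / 2)\<close>, so that
    averaging over signs multiplies \<open>D b\<close> by
    \<open>cos (- (pi / 2)) = 0\<close>.\<close>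
  let ?f = "\<lambda>b v. 1 + (- C b) * cos (ip d v (Y b) + 0) + D b * cos (ip d v (Y b) + (- (pi / 2)))"
  have key: "(\<Sum>b\<in>I. ?f b v) \<le> c * quad d A v + (1 / (2 * s\<^sup>2)) * quad d id_mat v + (c * (s\<^sup>2 * mat_trace d A) + t)" for v
  proof -
    have eq: "exponent d c A I Y (shift d v \<theta>) =
        (\<Sum>b\<in>I. 1 - (cos (ip d \<theta> (Y b)) * cos (ip d v (Y b)) - sin (ip d \<theta> (Y b)) * sin (ip d v (Y b))))
        - c * quad d A (shift d v \<theta>)" for \<theta>
      by (simp add: exponent_def ip_shift cos_add)
    have int: "integrable (gauss d s) (\<lambda>\<theta>. 1 - (cos (ip d \<theta> (Y b)) * cos (ip d v (Y b)) - sin (ip d \<theta> (Y b)) * sin (ip d v (Y b))))" for b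
      using int_cos int_sin by auto
    have val: "(\<integral>\<theta>. 1 - (cos (ip d \<theta> (Y b)) * cos (ip d v (Y b)) - sin (ip d \<theta> (Y b)) * sin (ip d v (Y b))) \<partial>gauss d s)
        = ?f b v" for b
      using int_cos int_sin by (simp add: prob_space C_def D_def cos_diff)
    have "(\<integral>\<theta>. exponent d c A I Y (shift d v \<theta>) \<partial>gauss d s) =
        (\<Sum>b\<in>I. ?f b v) - c * (quad d A v + s\<^sup>2 * mat_trace d A)"
      unfolding eq using int gauss_quad_shift[OF s] val
      by (subst Bochner_Integration.integral_diff) (auto simp: Bochner_Integration.integral_sum)
    moreover have "(\<integral>\<theta>. exponent d c A I Y (shift d v \<theta>) \<partial>gauss d s) \<le> ip d v v / (2 * s\<^sup>2) + t"
    proof (rule gauss_change_of_measure[OF s _ exp_h])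
      show "integrable (gauss d s) (\<lambda>\<theta>. exponent d c A I Y (shift d v \<theta>))"
        unfolding eq using int gauss_quad_shift(1)[OF s] by auto
    qed measurable
    ultimately show ?thesis by (simp add: ip_eq_quad algebra_simps)
  qed
  have "(\<Sum>b\<in>I. 1 - cos_weight d U (Y b)) \<le> (\<Sum>b\<in>I. 1 - C b * cos_weight d U (Y b))"
  proof (intro sum_mono diff_left_mono)
    fix b assume "b \<in> I"
    then show "C b * cos_weight d U (Y b) \<le> cos_weight d U (Y b)"
      using mult_right_mono[OF C[of b] w] by simp
  qed
  also have "\<dots> = sign_avg U (\<lambda>v. \<Sum>b\<in>I. ?f b v)"
    by (subst sign_avg_sum, intro sum.cong refl, subst sign_avg_add, subst sign_avg_add,
        subst sign_avg_scale, subst sign_avg_scale, subst sign_avg_const, subst sign_avg_cos, subst sign_avg_cos) simp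
  also have "\<dots> \<le> sign_avg U (\<lambda>v. c * quad d A v + (1 / (2 * s\<^sup>2)) * quad d id_mat v + (c * (s\<^sup>2 * mat_trace d A) + t))"
    by (rule sign_avg_mono) (rule key)
  also have "\<dots> = c * (\<Sum>u\<leftarrow>U. quad d A u) + (1 / (2 * s\<^sup>2)) * (\<Sum>u\<leftarrow>U. ip d u u) + (c * (s\<^sup>2 * mat_trace d A) + t)"
    by (simp only: sign_avg_add sign_avg_scale sign_avg_const sign_avg_quad0 ip_eq_quad)
  finally show ?thesis by (simp add: algebra_simps)
qed

section \<open>Bucket means of an independent sample\<close>

text \<open>Unlike \<open>emp_mean\<close>, this is not truncated at \<open>d\<close>; inner
  products in dimension \<open>d\<close> cannot tell the difference, by \<open>ip_emp_mean\<close>,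
  and measurability becomes a matter of finite sums.\<close>

definition block :: "(nat \<Rightarrow> real) \<Rightarrow> nat set \<Rightarrow> (nat \<Rightarrow> nat \<Rightarrow> real) \<Rightarrow> nat \<Rightarrow> real" where
  "block \<mu> B s i = (\<Sum>j\<in>B. s j i) / real (card B) - \<mu> i"

lemma ip_block:
  assumes "finite B" "B \<noteq> {}"
  shows "ip d \<theta> (block \<mu> B s) = (\<Sum>j\<in>B. ip d \<theta> (\<lambda>i. s j i - \<mu> i)) / real (card B)"
proof -
  have "block \<mu> B s i = (\<Sum>j\<in>B. s j i - \<mu> i) / real (card B)" for i
    using assms by (simp add: block_def sum_subtractf diff_divide_distrib)
  then have "ip d \<theta> (block \<mu> B s) = (\<Sum>i<d. \<Sum>j\<in>B. \<theta> i * (s j i - \<mu> i)) / real (card B)"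
    by (simp add: ip_def sum_divide_distrib sum_distrib_left)
  then show ?thesis by (subst (asm) sum.swap) (simp add: ip_def)
qed

lemma ip_emp_mean:
  "ip d \<theta> (\<lambda>i. emp_mean d (points s B) i - \<mu> i) = ip d \<theta> (block \<mu> B s)"
  unfolding ip_def
  by (intro sum.cong) (auto simp: block_def emp_mean_def points_def sum_unfold_sum_mset image_mset.compositionality o_def)

section \<open>Second moments of linear functionals of the sample\<close>

locale finite_covariance = P: prob_space P for P :: "(nat \<Rightarrow> real) measure" +
  fixes d :: nat
  assumes sets_P [measurable_cong]: "sets P = sets (Rd d)"
    and square_integrable: "\<And>i. i < d \<Longrightarrow> integrable P (\<lambda>x. (x i)\<^sup>2)"
begin

abbreviation "\<mu> \<equiv> mean_vec P"
abbreviation "\<Sigma> \<equiv> cov_mat P"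

lemma measurable_coordinate [measurable]: "i < d \<Longrightarrow> (\<lambda>x. x i) \<in> borel_measurable P"
  unfolding measurable_cong_sets[OF sets_P refl] Rd_def by measurable

lemma integrable_coordinate: "i < d \<Longrightarrow> integrable P (\<lambda>x. x i)"
  using P.square_integrable_imp_integrable[of "\<lambda>x. x i"] square_integrable by simp

lemma integrable_centered_product:
  assumes "i < d" "j < d"
  shows "integrable P (\<lambda>x. (x i - \<mu> i) * (x j - \<mu> j))"
proof -
  have "integrable P (\<lambda>x. x i * x j)"
  proof (rule Bochner_Integration.integrable_bound)
    show "integrable P (\<lambda>x. (x i)\<^sup>2 + (x j)\<^sup>2)"
      using assms square_integrable by auto
    show "(\<lambda>x. x i * x j) \<in> borel_measurable P" using assms by measurable
    have "\<bar>a * b\<bar> \<le> a\<^sup>2 + b\<^sup>2" for a b :: real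
    proof -
      have "2 * \<bar>a\<bar> * \<bar>b\<bar> \<le> \<bar>a\<bar>\<^sup>2 + \<bar>b\<bar>\<^sup>2" by (rule sum_squares_bound)
      moreover have "0 \<le> \<bar>a\<bar> * \<bar>b\<bar>" by simp
      ultimately have "\<bar>a\<bar> * \<bar>b\<bar> \<le> \<bar>a\<bar>\<^sup>2 + \<bar>b\<bar>\<^sup>2" by linarith
      then show ?thesis by (simp add: abs_mult)
    qed
    then show "AE x in P. norm (x i * x j) \<le> norm ((x i)\<^sup>2 + (x j)\<^sup>2)"
      by (auto intro!: AE_I2)
  qed
  then have "integrable P (\<lambda>x. x i * x j - \<mu> i * x j - \<mu> j * x i + \<mu> i * \<mu> j)"
    using assms integrable_coordinate by auto
  then show ?thesis by (simp add: algebra_simps)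
qed

definition lin :: "(nat \<Rightarrow> real) \<Rightarrow> (nat \<Rightarrow> real) \<Rightarrow> real" where
  "lin \<theta> x = ip d \<theta> (\<lambda>i. x i - \<mu> i)"

lemma integrable_lin: "integrable P (lin \<theta>)"
  unfolding lin_def[abs_def] ip_def
  by (intro Bochner_Integration.integrable_sum integrable_mult_right Bochner_Integration.integrable_diff
      integrable_coordinate P.integrable_const) simp

lemma integral_lin: "(\<integral>x. lin \<theta> x \<partial>P) = 0"
proof -
  have int: "integrable P (\<lambda>x. x i - \<mu> i)" if "i < d" for i
    using integrable_coordinate[OF that] by simp
  have m0: "(\<integral>x. x i - \<mu> i \<partial>P) = 0" if "i < d" for i
    using integrable_coordinate[OF that]
    by (subst Bochner_Integration.integral_diff) (simp_all add: P.prob_space mean_vec_def)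
  have "(\<integral>x. lin \<theta> x \<partial>P) = (\<Sum>i<d. \<integral>x. \<theta> i * (x i - \<mu> i) \<partial>P)"
    unfolding lin_def[abs_def] ip_def by (intro Bochner_Integration.integral_sum integrable_mult_right int) simp
  also have "\<dots> = (\<Sum>i<d. \<theta> i * (\<integral>x. x i - \<mu> i \<partial>P))"
    by (intro sum.cong refl integral_mult_right int) simp
  also have "\<dots> = 0" by (rule sum.neutral) (simp add: m0)
  finally show ?thesis .
qed

lemma lin_square: "(lin \<theta> x)\<^sup>2 = (\<Sum>i<d. \<Sum>j<d. \<theta> i * \<theta> j * ((x i - \<mu> i) * (x j - \<mu> j)))"
  unfolding lin_def ip_def power2_eq_square sum_product
  by (intro sum.cong refl) (simp only: mult_ac)

lemma lin_square_moment:
  shows "integrable P (\<lambda>x. (lin \<theta> x)\<^sup>2)" and "(\<integral>x. (lin \<theta> x)\<^sup>2 \<partial>P) = quad d \<Sigma> \<theta>"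
proof -
  let ?f = "\<lambda>i j x. \<theta> i * \<theta> j * ((x i - \<mu> i) * (x j - \<mu> j))"
  have int: "integrable P (?f i j)" if "i < d" "j < d" for i j
    by (rule integrable_mult_right) (rule integrable_centered_product[OF that])
  have int': "integrable P (\<lambda>x. \<Sum>j<d. ?f i j x)" if "i < d" for i
    by (rule Bochner_Integration.integrable_sum) (simp only: int that lessThan_iff)
  show "integrable P (\<lambda>x. (lin \<theta> x)\<^sup>2)"
    unfolding lin_square by (rule Bochner_Integration.integrable_sum) (simp only: int' lessThan_iff)
  have "(\<integral>x. (lin \<theta> x)\<^sup>2 \<partial>P) = (\<Sum>i<d. \<integral>x. (\<Sum>j<d. ?f i j x) \<partial>P)"
    unfolding lin_square by (rule Bochner_Integration.integral_sum) (simp only: int' lessThan_iff)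
  also have "\<dots> = (\<Sum>i<d. \<Sum>j<d. \<integral>x. ?f i j x \<partial>P)"
    by (intro sum.cong refl Bochner_Integration.integral_sum) (simp only: int lessThan_iff)
  also have "\<dots> = (\<Sum>i<d. \<Sum>j<d. \<Sigma> i j * (\<theta> i * \<theta> j))"
    unfolding cov_mat_def by (intro sum.cong refl) (simp add: mult.commute)
  finally show "(\<integral>x. (lin \<theta> x)\<^sup>2 \<partial>P) = quad d \<Sigma> \<theta>" by (simp add: quad_def)
qed

lemma measurable_lin [measurable]: "lin \<theta> \<in> borel_measurable P"
  using integrable_lin by auto

text \<open>By independence and centring the off-diagonal products vanish, so only
  \<open>card B\<close> of the \<open>(card B)\<^sup>2\<close> terms survive.\<close>

lemma block_second_moment:
  assumes J: "finite J" and B: "B \<subseteq> J" "B \<noteq> {}"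
  shows "integrable (PiM J (\<lambda>_. P)) (\<lambda>s. (ip d \<theta> (block \<mu> B s))\<^sup>2)"
    and "(\<integral>s. (ip d \<theta> (block \<mu> B s))\<^sup>2 \<partial>PiM J (\<lambda>_. P)) = quad d \<Sigma> \<theta> / real (card B)"
proof -
  have finB: "finite B" using finite_subset[OF B(1) J] .
  have cB: "0 < real (card B)" using finB B by (simp add: card_gt_0_iff)
  have eq: "(ip d \<theta> (block \<mu> B s))\<^sup>2 = (\<Sum>i\<in>B. \<Sum>j\<in>B. lin \<theta> (s i) * lin \<theta> (s j)) / (real (card B))\<^sup>2" for s
  proof -
    have "(\<Sum>j\<in>B. lin \<theta> (s j))\<^sup>2 = (\<Sum>i\<in>B. \<Sum>j\<in>B. lin \<theta> (s i) * lin \<theta> (s j))"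
      by (simp only: power2_eq_square sum_product)
    then show ?thesis by (simp only: ip_block[OF finB B(2)] lin_def power_divide)
  qed
  note prod = iid_coordinates_product[OF P.prob_space_axioms J _ _ integrable_lin lin_square_moment(1) integral_lin]
  have int: "integrable (PiM J (\<lambda>_. P)) (\<lambda>s. lin \<theta> (s i) * lin \<theta> (s j))" if "i \<in> B" "j \<in> B" for i j
    using that B by (intro prod(1)) auto
  have val: "(\<integral>s. lin \<theta> (s i) * lin \<theta> (s j) \<partial>PiM J (\<lambda>_. P)) = (if i = j then quad d \<Sigma> \<theta> else 0)"
    if "i \<in> B" "j \<in> B" for i j
    using prod(2)[of i j] subsetD[OF B(1) that(1)] subsetD[OF B(1) that(2)] by (simp add: lin_square_moment(2))
  show "integrable (PiM J (\<lambda>_. P)) (\<lambda>s. (ip d \<theta> (block \<mu> B s))\<^sup>2)"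
    unfolding eq using int by (intro integrable_divide Bochner_Integration.integrable_sum) auto
  have "(\<integral>s. (\<Sum>i\<in>B. \<Sum>j\<in>B. lin \<theta> (s i) * lin \<theta> (s j)) \<partial>PiM J (\<lambda>_. P))
      = (\<Sum>i\<in>B. \<integral>s. (\<Sum>j\<in>B. lin \<theta> (s i) * lin \<theta> (s j)) \<partial>PiM J (\<lambda>_. P))"
    using int by (intro Bochner_Integration.integral_sum Bochner_Integration.integrable_sum) auto
  also have "\<dots> = (\<Sum>i\<in>B. \<Sum>j\<in>B. \<integral>s. lin \<theta> (s i) * lin \<theta> (s j) \<partial>PiM J (\<lambda>_. P))"
    using int by (intro sum.cong refl Bochner_Integration.integral_sum) auto
  also have "\<dots> = (\<Sum>i\<in>B. \<Sum>j\<in>B. if i = j then quad d \<Sigma> \<theta> else 0)"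
    by (intro sum.cong refl val) auto
  also have "\<dots> = real (card B) * quad d \<Sigma> \<theta>"
    using finB by simp
  finally show "(\<integral>s. (ip d \<theta> (block \<mu> B s))\<^sup>2 \<partial>PiM J (\<lambda>_. P)) = quad d \<Sigma> \<theta> / real (card B)"
    unfolding eq using cB by (simp add: power2_eq_square)
qed

section \<open>Exponential moments over disjoint buckets\<close>

lemma indep_coordinates:
  assumes "J \<noteq> {}"
  shows "prob_space.indep_vars (PiM J (\<lambda>_. P)) (\<lambda>_. P) (\<lambda>i s. s i) J"
proof -
  interpret Q: prob_space "PiM J (\<lambda>_. P)" by (intro prob_space_PiM P.prob_space_axioms)
  have "distr (PiM J (\<lambda>_. P)) (PiM J (\<lambda>_. P)) (\<lambda>x. \<lambda>i\<in>J. x i) = distr (PiM J (\<lambda>_. P)) (PiM J (\<lambda>_. P)) (\<lambda>x. x)"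
    by (intro distr_cong refl) (auto simp: space_PiM PiE_iff extensional_def fun_eq_iff)
  also have "\<dots> = PiM J (\<lambda>_. P)" by simp
  also have "\<dots> = PiM J (\<lambda>i. distr (PiM J (\<lambda>_. P)) P (\<lambda>s. s i))"
    by (intro PiM_cong refl distr_PiM_component[symmetric] P.prob_space_axioms)
  finally show ?thesis
    by (subst Q.indep_vars_iff_distr_eq_PiM'[OF assms]) auto
qed

text \<open>By \<open>exp (1 - cos a) \<le> 1 + 2 a\<^sup>2\<close>, each bucket contributes at most \<open>exp (2 quad \<Sigma> \<theta> / m)\<close>, which the
  quadratic term of the exponent compensates.\<close>

lemma block_mgf_le_1:
  assumes J: "finite J" "J \<noteq> {}" and \<B>: "finite \<B>" "disjoint \<B>" "\<And>B. B \<in> \<B> \<Longrightarrow> B \<subseteq> J"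
    and m: "0 < m" "\<And>B. B \<in> \<B> \<Longrightarrow> card B = m"
    and c: "c = 2 * real (card \<B>) / real m"
  shows "(\<integral>\<^sup>+s. ennreal (exp (exponent d c \<Sigma> \<B> (\<lambda>B. block \<mu> B s) \<theta>)) \<partial>PiM J (\<lambda>_. P)) \<le> 1"
proof -
  let ?Q = "PiM J (\<lambda>_. P)"
  interpret Q: prob_space ?Q by (intro prob_space_PiM P.prob_space_axioms)
  \<comment> \<open>\<open>f B\<close> reads \<open>s\<close> only on \<open>B\<close>, so
    restricting \<open>s\<close> to \<open>B\<close> changes nothing and disjoint buckets give
    independent factors.\<close>
  define f where "f B s = exp (1 - cos ((\<Sum>j\<in>B. lin \<theta> (s j)) / real m))" for B and s :: "nat \<Rightarrow> nat \<Rightarrow> real"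
  have B: "finite B" "B \<noteq> {}" if "B \<in> \<B>" for B
    using that m J(1) \<B>(3) finite_subset by (blast, force)
  have f: "f B s = exp (1 - cos (ip d \<theta> (block \<mu> B s)))" if "B \<in> \<B>" for B s
    unfolding f_def ip_block[OF B[OF that]] by (simp add: lin_def m(2)[OF that])
  have "Q.indep_vars (\<lambda>B. PiM B (\<lambda>_. P)) (\<lambda>B s. restrict (\<lambda>i. s i) B) \<B>"
  proof (rule Q.indep_vars_restrict[OF indep_coordinates[OF J(2)]])
    show "B \<subseteq> J" if "B \<in> \<B>" for B using \<B>(3) that .
    show "disjoint_family_on (\<lambda>B. B) \<B>"
      using \<B>(2) unfolding disjoint_family_on_def disjoint_def by blast
  qed
  then have "Q.indep_vars (\<lambda>_. borel) (\<lambda>B s. f B (restrict (\<lambda>i. s i) B)) \<B>"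
    by (rule Q.indep_vars_compose2) (auto simp: f_def)
  moreover have "f B (restrict (\<lambda>i. s i) B) = f B s" for B s
    unfolding f_def by simp
  ultimately have indep: "Q.indep_vars (\<lambda>_. borel) f \<B>" by simp
  have "(\<integral>\<^sup>+s. ennreal (exp (\<Sum>B\<in>\<B>. 1 - cos (ip d \<theta> (block \<mu> B s)))) \<partial>?Q) = (\<integral>\<^sup>+s. (\<Prod>B\<in>\<B>. ennreal (f B s)) \<partial>?Q)"
    by (intro nn_integral_cong) (simp add: exp_sum \<B>(1) prod_ennreal f)
  also have "\<dots> = (\<Prod>B\<in>\<B>. \<integral>\<^sup>+s. ennreal (f B s) \<partial>?Q)"
    by (rule Q.indep_vars_nn_integral[OF \<B>(1) Q.indep_vars_compose2[OF indep]]) auto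
  also have "\<dots> \<le> (\<Prod>B\<in>\<B>. ennreal (exp (2 * quad d \<Sigma> \<theta> / real m)))"
  proof (rule prod_mono_ennreal)
    fix B assume BB: "B \<in> \<B>"
    note sm = block_second_moment[OF J(1) \<B>(3)[OF BB] B(2)[OF BB], of \<theta>]
    have "(\<integral>\<^sup>+s. ennreal (f B s) \<partial>?Q) \<le> (\<integral>\<^sup>+s. ennreal (1 + 2 * (ip d \<theta> (block \<mu> B s))\<^sup>2) \<partial>?Q)"
      unfolding f[OF BB] by (intro nn_integral_mono ennreal_leI exp_one_minus_cos_le)
    also have "\<dots> = ennreal (\<integral>s. 1 + 2 * (ip d \<theta> (block \<mu> B s))\<^sup>2 \<partial>?Q)"
      using sm(1) by (intro nn_integral_eq_integral) auto
    also have "(\<integral>s. 1 + 2 * (ip d \<theta> (block \<mu> B s))\<^sup>2 \<partial>?Q) = 1 + 2 * quad d \<Sigma> \<theta> / real m"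
      using sm m(2)[OF BB] by (simp add: Q.prob_space)
    also have "ennreal \<dots> \<le> ennreal (exp (2 * quad d \<Sigma> \<theta> / real m))"
      by (intro ennreal_leI) simp
    finally show "(\<integral>\<^sup>+s. ennreal (f B s) \<partial>?Q) \<le> ennreal (exp (2 * quad d \<Sigma> \<theta> / real m))" .
  qed
  also have "\<dots> = ennreal (exp (c * quad d \<Sigma> \<theta>))"
    by (simp add: c ennreal_power exp_of_nat_mult[symmetric] ac_simps)
  finally have le: "(\<integral>\<^sup>+s. ennreal (exp (\<Sum>B\<in>\<B>. 1 - cos (ip d \<theta> (block \<mu> B s)))) \<partial>?Q) \<le> ennreal (exp (c * quad d \<Sigma> \<theta>))" .
  have [measurable]: "(\<lambda>s. exp (\<Sum>B\<in>\<B>. 1 - cos (ip d \<theta> (block \<mu> B s)))) \<in> borel_measurable ?Q"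
  proof -
    have "(\<lambda>s. \<Prod>B\<in>\<B>. f B s) \<in> borel_measurable ?Q"
      using indep by (intro borel_measurable_prod) (auto simp: Q.indep_vars_def)
    then show ?thesis by (simp add: exp_sum \<B>(1) f)
  qed
  have "(\<integral>\<^sup>+s. ennreal (exp (exponent d c \<Sigma> \<B> (\<lambda>B. block \<mu> B s) \<theta>)) \<partial>?Q) =
      (\<integral>\<^sup>+s. ennreal (exp (- (c * quad d \<Sigma> \<theta>))) * ennreal (exp (\<Sum>B\<in>\<B>. 1 - cos (ip d \<theta> (block \<mu> B s)))) \<partial>?Q)"
    by (intro nn_integral_cong) (simp add: exponent_def ennreal_mult[symmetric] exp_add[symmetric])
  also have "\<dots> = ennreal (exp (- (c * quad d \<Sigma> \<theta>))) *
      (\<integral>\<^sup>+s. ennreal (exp (\<Sum>B\<in>\<B>. 1 - cos (ip d \<theta> (block \<mu> B s)))) \<partial>?Q)"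
    by (rule nn_integral_cmult) measurable
  also have "\<dots> \<le> ennreal (exp (- (c * quad d \<Sigma> \<theta>))) * ennreal (exp (c * quad d \<Sigma> \<theta>))"
    by (intro mult_left_mono le) simp
  also have "\<dots> = 1" by (simp add: ennreal_mult[symmetric] exp_minus)
  finally show ?thesis .
qed

text \<open>One event serves all directions at once, because the integral over the prior contains no
  direction \<open>v\<close>. From membership on, the argument is deterministic.\<close>

definition good_samples :: "nat set \<Rightarrow> real \<Rightarrow> real \<Rightarrow> real \<Rightarrow> nat set set \<Rightarrow> (nat \<Rightarrow> nat \<Rightarrow> real) set" where
  "good_samples J c r t \<B> = {s \<in> space (PiM J (\<lambda>_. P)).
     (\<integral>\<^sup>+\<theta>. ennreal (exp (exponent d c \<Sigma> \<B> (\<lambda>B. block \<mu> B s) \<theta>)) \<partial>gauss d r) \<le> ennreal (exp t)}"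

text \<open>The prior does not depend on the sample, so Tonelli's theorem exchanges the integrals,
  and the inner one is at most 1 by \<open>block_mgf_le_1\<close>. Markov's inequality at level
  \<open>exp t\<close> gives the probability.\<close>

lemma good_samples_prob:
  assumes J: "finite J" "J \<noteq> {}" and \<B>: "finite \<B>" "disjoint \<B>" "\<And>B. B \<in> \<B> \<Longrightarrow> B \<subseteq> J"
    and m: "0 < m" "\<And>B. B \<in> \<B> \<Longrightarrow> card B = m"
    and c: "c = 2 * real (card \<B>) / real m" and r: "0 < r"
  shows "good_samples J c r t \<B> \<in> sets (PiM J (\<lambda>_. P))"
    and "measure (PiM J (\<lambda>_. P)) (good_samples J c r t \<B>) \<ge> 1 - exp (- t)"
proof -
  let ?Q = "PiM J (\<lambda>_. P)"
  interpret Q: prob_space ?Q by (intro prob_space_PiM P.prob_space_axioms)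
  interpret G: prob_space "gauss d r" using r by (rule prob_space_gauss)
  interpret QG: pair_sigma_finite ?Q "gauss d r" ..
  let ?F = "\<lambda>s \<theta>. ennreal (exp (exponent d c \<Sigma> \<B> (\<lambda>B. block \<mu> B s) \<theta>))"
  have [measurable]: "(\<lambda>(s, \<theta>). ?F s \<theta>) \<in> borel_measurable (?Q \<Otimes>\<^sub>M gauss d r)"
  proof -
    have [measurable]: "(\<lambda>x. fst x j i) \<in> borel_measurable (?Q \<Otimes>\<^sub>M gauss d r)" if "j \<in> J" "i < d" for i j
    proof -
      have "(\<lambda>x. fst x j) \<in> ?Q \<Otimes>\<^sub>M gauss d r \<rightarrow>\<^sub>M P" using that by measurable
      from measurable_compose[OF this measurable_coordinate[OF that(2)]] show ?thesis by simp
    qed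
    have [measurable]: "(\<lambda>x. ip d (snd x) (block \<mu> B (fst x))) \<in> borel_measurable (?Q \<Otimes>\<^sub>M gauss d r)" if "B \<in> \<B>" for B
    proof -
      have "B \<subseteq> J" using \<B> that by blast
      then show ?thesis unfolding ip_def block_def by (intro borel_measurable_sum borel_measurable_times
        borel_measurable_diff borel_measurable_divide) (auto intro!: borel_measurable_sum)
    qed
    show ?thesis unfolding exponent_def case_prod_beta by measurable
  qed
  have [measurable]: "(\<lambda>s. \<integral>\<^sup>+\<theta>. ?F s \<theta> \<partial>gauss d r) \<in> borel_measurable ?Q"
    by (rule G.borel_measurable_nn_integral) measurable
  show G: "good_samples J c r t \<B> \<in> sets ?Q"
    unfolding good_samples_def by measurable
  have "(\<integral>\<^sup>+s. \<integral>\<^sup>+\<theta>. ?F s \<theta> \<partial>gauss d r \<partial>?Q) = (\<integral>\<^sup>+\<theta>. \<integral>\<^sup>+s. ?F s \<theta> \<partial>?Q \<partial>gauss d r)"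
    by (rule QG.Fubini'[symmetric]) measurable
  also have "\<dots> \<le> (\<integral>\<^sup>+\<theta>. 1 \<partial>gauss d r)"
    by (intro nn_integral_mono block_mgf_le_1[OF J \<B> m c])
  also have "\<dots> = 1" by (simp add: G.emeasure_space_1)
  finally have le1: "(\<integral>\<^sup>+s. \<integral>\<^sup>+\<theta>. ?F s \<theta> \<partial>gauss d r \<partial>?Q) \<le> 1" .
  have "emeasure ?Q (space ?Q - good_samples J c r t \<B>) \<le>
      emeasure ?Q {s \<in> space ?Q. 1 \<le> ennreal (exp (- t)) * (\<integral>\<^sup>+\<theta>. ?F s \<theta> \<partial>gauss d r)}"
  proof (rule emeasure_mono, safe)
    fix s assume s: "s \<in> space ?Q" "s \<notin> good_samples J c r t \<B>"
    then have "ennreal (exp t) \<le> (\<integral>\<^sup>+\<theta>. ?F s \<theta> \<partial>gauss d r)"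
      by (auto simp: good_samples_def)
    then have "ennreal (exp (- t)) * ennreal (exp t) \<le> ennreal (exp (- t)) * (\<integral>\<^sup>+\<theta>. ?F s \<theta> \<partial>gauss d r)"
      by (intro mult_left_mono) auto
    then show "1 \<le> ennreal (exp (- t)) * (\<integral>\<^sup>+\<theta>. ?F s \<theta> \<partial>gauss d r)"
      by (simp add: ennreal_mult[symmetric] exp_minus)
  qed measurable
  also have "\<dots> \<le> ennreal (exp (- t)) * (\<integral>\<^sup>+s. (\<integral>\<^sup>+\<theta>. ?F s \<theta> \<partial>gauss d r) * indicator (space ?Q) s \<partial>?Q)"
    by (rule nn_integral_Markov_inequality) measurable
  also have "\<dots> = ennreal (exp (- t)) * (\<integral>\<^sup>+s. \<integral>\<^sup>+\<theta>. ?F s \<theta> \<partial>gauss d r \<partial>?Q)"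
    by (intro arg_cong2[where f = "(*)"] refl nn_integral_cong) simp
  also have "\<dots> \<le> ennreal (exp (- t)) * 1"
    by (intro mult_left_mono le1) simp
  finally have "measure ?Q (space ?Q - good_samples J c r t \<B>) \<le> exp (- t)"
    by (simp add: Q.emeasure_eq_measure)
  then show "measure ?Q (good_samples J c r t \<B>) \<ge> 1 - exp (- t)"
    using Q.prob_compl[OF G] by simp
qed

end

section \<open>Alignment and bucketings\<close>

lemma submset_mset_set_eq:
  assumes "B \<subseteq># mset_set I"
  shows "mset_set (set_mset B) = B"
proof (rule multiset_eqI)
  fix x
  have "count B x \<le> count (mset_set I) x" using assms by (simp add: subseteq_mset_def)
  also have "\<dots> \<le> 1" by (cases "finite I"; cases "x \<in> I") auto
  finally have "count B x \<le> 1" .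
  show "count (mset_set (set_mset B)) x = count B x"
  proof (cases "x \<in># B")
    case True
    then have "0 < count B x" by simp
    with \<open>count B x \<le> 1\<close> have "count B x = 1" by linarith
    then show ?thesis using True by simp
  qed (simp add: not_in_iff)
qed

text \<open>The multiset equations are split at the level of indices: \<open>I2\<close> carries the
  inserted points of \<open>t\<close> and \<open>J2\<close> the removed points of \<open>s\<close>.
  Undoing the corruption on \<open>I2\<close> yields a family \<open>t'\<close> with the same
  multiset of values as \<open>s\<close>, hence a permutation of it.\<close>

lemma corrupted_alignment:
  fixes s t :: "'i \<Rightarrow> 'a"
  assumes I: "finite I" and corr: "corrupted \<epsilon> (points t I) (points s I)"
  obtains p where "p permutes I" "real (card {i \<in> I. t i \<noteq> s (p i)}) \<le> \<epsilon> * real (card I)"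
proof -
  obtain R A where R: "R \<subseteq># points s I" "real (size R) \<le> \<epsilon> * real (card I)" "size A = size R"
    and t: "image_mset t (mset_set I) = (points s I - R) + A"
    using corr unfolding corrupted_def by (auto simp: points_def)
  obtain T1 T2 where T: "mset_set I = T1 + T2" "points s I - R = image_mset t T1" "A = image_mset t T2"
    using image_mset_eq_plusD[OF t] by blast
  have "image_mset s (mset_set I) = (points s I - R) + R" using R(1) by (simp add: points_def)
  then obtain S1 S2 where S: "mset_set I = S1 + S2" "points s I - R = image_mset s S1" "R = image_mset s S2"
    using image_mset_eq_plusD by blast
  define I2 where "I2 = set_mset T2"
  define J2 where "J2 = set_mset S2"
  have I2: "mset_set I2 = T2" and J2: "mset_set J2 = S2"
    unfolding I2_def J2_def by (rule submset_mset_set_eq[of _ I], simp add: T(1))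
      (rule submset_mset_set_eq[of _ I], simp add: S(1))
  have fin: "finite I2" "finite J2" by (auto simp: I2_def J2_def)
  have cI2: "card I2 = size R" using R(3) T(3) by (simp flip: I2)
  have "card J2 = size R" using S(3) by (simp flip: J2)
  then obtain b where b: "bij_betw b I2 J2"
    using finite_same_card_bij[OF fin] cI2 by auto
  define t' where "t' i = (if i \<in> I2 then s (b i) else t i)" for i
  \<comment> \<open>Retained and replaced indices are disjoint, so the repair on \<open>I2\<close>
    leaves the retained points alone.\<close>
  have "x \<notin># T2" if "x \<in># T1" for x
  proof
    assume "x \<in># T2"
    then have "0 < count T1 x" "0 < count T2 x" using that by simp_all
    moreover have "count (mset_set I) x = count T1 x + count T2 x" using T(1) by simp
    moreover have "count (mset_set I) x \<le> 1" using I by (cases "x \<in> I") auto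
    ultimately show False by linarith
  qed
  then have "image_mset t' T1 = image_mset t T1"
    by (intro image_mset_cong) (auto simp: t'_def I2_def)
  moreover have "image_mset t' T2 = image_mset s (image_mset b (mset_set I2))"
    unfolding I2[symmetric] multiset.map_comp using fin by (intro image_mset_cong) (auto simp: t'_def)
  moreover have "image_mset b (mset_set I2) = mset_set J2"
    using b by (simp add: image_mset_mset_set bij_betw_def)
  ultimately have "image_mset t' T1 = points s I - R" "image_mset t' T2 = R"
    using T(2) S(3) J2 by simp_all
  then have "image_mset t' (mset_set I) = (points s I - R) + R"
    by (simp add: T(1))
  then have "image_mset t' (mset_set I) = image_mset s (mset_set I)"
    using R(1) by (simp add: points_def)
  then obtain p where p: "p permutes I" "\<forall>i\<in>I. t' i = s (p i)"
    using image_mset_eq_implies_permutes[OF I] by metis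
  have "i \<in> I2" if "i \<in> I" "t i \<noteq> s (p i)" for i
    using bspec[OF p(2) that(1)] that(2) by (cases "i \<in> I2") (simp_all add: t'_def)
  then have "{i \<in> I. t i \<noteq> s (p i)} \<subseteq> I2" by blast
  then have "card {i \<in> I. t i \<noteq> s (p i)} \<le> card I2" using fin by (intro card_mono)
  then show thesis using that[OF p(1)] R(2) cI2 by simp
qed

lemma mset_set_memE:
  assumes "x \<in># mset_set A" obtains "x \<in> A"
  using assms by (cases "finite A") auto

text \<open>Buckets are disjoint, so choosing one differing index from each affected bucket is
  injective, and at most as many means change as points. The budget is counted against
  \<open>card \<B>\<close>, which is why \<open>k\<close> has to be a large multiple of the number
  of corrupted points.\<close>

lemma corrupted_bucket_means:
  assumes \<B>: "finite \<B>" "disjoint \<B>" "\<And>B. B \<in> \<B> \<Longrightarrow> B \<subseteq> I" and I: "finite I"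
    and bad: "real (card {i \<in> I. t i \<noteq> s i}) \<le> \<epsilon> * real (card \<B>)"
  shows "corrupted \<epsilon> (bucket_means d t \<B>) (bucket_means d s \<B>)"
proof -
  define bad where "bad = {B \<in> \<B>. \<exists>i\<in>B. t i \<noteq> s i}"
  have badB: "bad \<subseteq> \<B>" "finite bad" using \<B>(1) by (auto simp: bad_def)
  have "\<forall>B\<in>bad. \<exists>i. i \<in> B \<and> t i \<noteq> s i" by (auto simp: bad_def)
  then obtain f where f: "\<And>B. B \<in> bad \<Longrightarrow> f B \<in> B \<and> t (f B) \<noteq> s (f B)" by metis
  have "inj_on f bad"
  proof (rule inj_onI)
    fix B C assume "B \<in> bad" "C \<in> bad" "f B = f C"
    then have "f B \<in> B \<inter> C" using f by fastforce
    then show "B = C" using \<B>(2) \<open>B \<in> bad\<close> \<open>C \<in> bad\<close> badB(1) by (auto simp: disjoint_def)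
  qed
  moreover have "f ` bad \<subseteq> {i \<in> I. t i \<noteq> s i}" using f \<B>(3) badB(1) by blast
  ultimately have card_bad: "card bad \<le> card {i \<in> I. t i \<noteq> s i}"
    using I by (intro card_inj_on_le) auto
  have "mset_set \<B> = mset_set (\<B> - bad) + mset_set bad"
    using badB \<B>(1) by (metis Diff_disjoint Diff_partition finite_Diff mset_set_Union sup_commute inf_commute)
  then have split: "bucket_means d u \<B> = bucket_means d u (\<B> - bad) + bucket_means d u bad" for u
    by (simp add: bucket_means_def)
  have "emp_mean d (points t B) = emp_mean d (points s B)" if "B \<in> \<B> - bad" for B
  proof -
    have "points t B = points s B"
      unfolding points_def using that by (intro image_mset_cong) (auto simp: bad_def elim!: mset_set_memE)
    then show ?thesis by simp
  qed
  then have "bucket_means d t (\<B> - bad) = bucket_means d s (\<B> - bad)"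
    unfolding bucket_means_def using \<B>(1) by (intro image_mset_cong) auto
  then have "bucket_means d t \<B> = bucket_means d s \<B> - bucket_means d s bad + bucket_means d t bad"
    by (simp add: split)
  moreover have "bucket_means d s bad \<subseteq># bucket_means d s \<B>" by (simp add: split[of s])
  moreover have "real (size (bucket_means d s bad)) \<le> \<epsilon> * real (size (bucket_means d s \<B>))"
    using card_bad bad by (simp add: bucket_means_def)
  ultimately show ?thesis
    unfolding corrupted_def by (intro exI[of _ "bucket_means d s bad"] exI[of _ "bucket_means d t bad"])
      (simp add: bucket_means_def)
qed

text \<open>Relabelling the sample amounts to relabelling the buckets; injectivity preserves bucket
  sizes and keeps distinct buckets distinct.\<close>

lemma bucket_means_permute:
  assumes "inj p"
  shows "bucket_means d (\<lambda>i. s (p i)) \<B> = bucket_means d s ((`) p ` \<B>)"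
proof -
  have "points (\<lambda>i. s (p i)) B = points s (p ` B)" for B
    using inj_on_subset[OF assms] unfolding points_def
    by (subst image_mset_mset_set[symmetric]) (auto simp: multiset.map_comp o_def)
  moreover have "inj_on ((`) p) \<B>" by (rule inj_onI) (simp add: inj_image_eq_iff[OF assms])
  ultimately show ?thesis
    unfolding bucket_means_def by (subst image_mset_mset_set[symmetric]) (auto simp: multiset.map_comp o_def)
qed

section \<open>The set of bucketings and its symmetry under permutations\<close>

lemma bucketingsD:
  assumes "\<B> \<in> bucketings n k"
  shows "disjoint \<B>" "\<And>B. B \<in> \<B> \<Longrightarrow> B \<subseteq> {..<n}" "card \<B> = k" "\<And>B. B \<in> \<B> \<Longrightarrow> card B = n div k" "finite \<B>"
proof -
  obtain I where I: "I \<subseteq> {..<n}" "partition_on I \<B>" using assms by (auto simp: bucketings_def)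
  show *: "B \<subseteq> {..<n}" if "B \<in> \<B>" for B using I that by (auto simp: partition_on_def)
  show "disjoint \<B>" using I by (simp add: partition_on_def)
  have "\<B> \<subseteq> Pow {..<n}" using * by blast
  then show "finite \<B>" by (rule finite_subset) simp
qed (use assms in \<open>auto simp: bucketings_def\<close>)

lemma finite_bucketings: "finite (bucketings n k)"
proof (rule finite_subset)
  show "bucketings n k \<subseteq> Pow (Pow {..<n})" using bucketingsD(2) by blast
qed simp

text \<open>Consecutive intervals of length \<open>n div k\<close> serve as buckets;
  \<open>k \<le> n\<close> makes them nonempty, as \<open>partition_on\<close> demands. The uniform
  measure on bucketings is thereby a probability.\<close>

lemma bucketings_nonempty:
  assumes k: "1 \<le> k" "k \<le> n"
  shows "bucketings n k \<noteq> {}"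
proof -
  define m where "m = n div k"
  have m: "0 < m" using k by (simp add: m_def div_greater_zero_iff)
  define b where "b j = {j * m..<j * m + m}" for j
  have disj: "b i \<inter> b j = {}" if "i < j" for i j
  proof -
    have "i * m + m \<le> j * m" using that mult_le_mono1[of "Suc i" j m] by simp
    then show ?thesis by (auto simp: b_def)
  qed
  then have disj': "b i \<inter> b j = {}" if "i \<noteq> j" for i j
    using that disj[of i j] disj[of j i] by (cases "i < j") (simp_all add: Int_commute)
  have ne: "b i \<noteq> {}" for i using m by (simp add: b_def)
  have inj: "inj b" using disj' ne by (metis injI inf.idem)
  have sub: "b j \<subseteq> {..<n}" if "j < k" for j
  proof -
    have "j * m + m \<le> k * m" using that mult_le_mono1[of "Suc j" k m] by simp
    also have "\<dots> \<le> n" by (simp add: m_def)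
    finally show ?thesis by (auto simp: b_def)
  qed
  have part: "partition_on (\<Union>(b ` {..<k})) (b ` {..<k})"
  proof (rule partition_onI)
    fix A B assume "A \<in> b ` {..<k}" "B \<in> b ` {..<k}" "A \<noteq> B"
    then show "disjnt A B" using disj' unfolding disjnt_def by (metis imageE)
  qed (use ne in auto)
  have crd: "card (b ` {..<k}) = k" using inj by (simp add: card_image inj_on_subset)
  have "b ` {..<k} \<in> bucketings n k"
  proof -
    have "\<Union>(b ` {..<k}) \<subseteq> {..<n}" using sub by blast
    moreover have "\<forall>B\<in>b ` {..<k}. card B = n div k" by (auto simp: b_def m_def)
    ultimately show ?thesis unfolding bucketings_def using part crd by blast
  qed
  then show ?thesis by blast
qed

text \<open>An injective self-map of a finite set is onto. This is the invariance of the uniform law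
  that absorbs the aligning permutation.\<close>

lemma bij_betw_bucketings:
  assumes p: "p permutes {..<n}"
  shows "bij_betw ((`) ((`) p)) (bucketings n k) (bucketings n k)"
proof -
  have inj: "inj p" using p by (rule permutes_inj)
  have inj': "inj ((`) p)" by (rule injI) (simp add: inj_image_eq_iff[OF inj])
  have inj'': "inj_on ((`) ((`) p)) (bucketings n k)"
    by (rule inj_onI) (simp add: inj_image_eq_iff[OF inj'])
  have "(`) p ` \<B> \<in> bucketings n k" if \<B>: "\<B> \<in> bucketings n k" for \<B>
  proof -
    obtain I where I: "I \<subseteq> {..<n}" "partition_on I \<B>" using \<B> by (auto simp: bucketings_def)
    have "partition_on (p ` I) ((`) p ` \<B>)"
    proof -
      have "{} \<notin> (`) p ` \<B>" using partition_onD3[OF I(2)] by auto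
      then show ?thesis using partition_on_inj_image[OF I(2) inj_on_subset[OF inj]] by simp
    qed
    moreover have "p ` I \<subseteq> {..<n}" using I(1) permutes_image[OF p] by blast
    moreover have "card ((`) p ` \<B>) = k"
      using bucketingsD(3)[OF \<B>] inj' by (simp add: card_image inj_on_subset)
    moreover have "\<forall>B\<in>(`) p ` \<B>. card B = n div k"
      using bucketingsD(4)[OF \<B>] inj by (auto simp: card_image inj_on_subset)
    ultimately show ?thesis unfolding bucketings_def by blast
  qed
  then have "(`) ((`) p) ` bucketings n k \<subseteq> bucketings n k" by blast
  then show ?thesis
    unfolding bij_betw_def using inj'' endo_inj_surj[OF finite_bucketings] by blast
qed

section \<open>Stability of the bucket means\<close>

lemma cos_weight_le_1: "cos_weight d U y \<le> 1"
proof -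
  have "\<bar>cos_weight d U y\<bar> \<le> 1"
  proof (induction U)
    case (Cons u U)
    have "\<bar>cos (ip d u y)\<bar> * \<bar>cos_weight d U y\<bar> \<le> 1 * 1"
      by (intro mult_mono Cons abs_cos_le_one) auto
    then show ?case by (simp add: cos_weight_def abs_mult)
  qed (simp add: cos_weight_def)
  then show ?thesis by linarith
qed

lemma sum_list_quad_le: "(\<Sum>u\<leftarrow>U. quad d A u) \<le> spectral_norm d A * (\<Sum>u\<leftarrow>U. ip d u u)"
  by (induction U) (auto simp: algebra_simps intro: add_mono quad_le_spectral_norm)

context finite_covariance
begin

lemma trace_cov_nonneg: "0 \<le> mat_trace d \<Sigma>"
  unfolding mat_trace_def cov_mat_def by (intro sum_nonneg integral_nonneg) auto

text \<open>The scale \<open>\<beta>\<close> makes the trace and spectral terms of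
  \<open>pac_bayes_cos\<close> small against \<open>k\<close>, and \<open>\<Lambda>\<close> exceeds
  \<open>\<beta>\<close> by enough to make the entropy of a near-minimal \<open>U\<close> small as
  well. The price appears in the second moment constant \<open>K\<close>, which
  \<open>\<delta>\<close> absorbs.\<close>

lemma good_samples_imp_stable:
  fixes n k m :: nat
  assumes k: "1 \<le> k" "k \<le> n" and m: "m = n div k"
    and \<B>: "finite \<B>" "card \<B> = k" "\<And>B. B \<in> \<B> \<Longrightarrow> card B = m"
    and nz: "0 < spectral_norm d \<Sigma>"
    and c: "c = 2 * real k / real m"
    and \<beta>: "\<beta> = 1000 * (mat_trace d \<Sigma> + spectral_norm d \<Sigma> * real k) / real m" and r: "r = 1 / sqrt \<beta>"
    and t: "t \<le> real k / 500"
    and \<delta>: "\<delta> = 10000 * (sqrt (eff_rank d \<Sigma> / real k) + 1)"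
    and s: "s \<in> good_samples J c r t \<B>"
  shows "\<exists>S'. S' \<subseteq># bucket_means d s \<B> \<and> real (size S') \<ge> 0.95 * real k \<and>
    is_stable d 0.1 \<delta> \<mu> (real k * spectral_norm d \<Sigma> / real n) S'"
proof -
  define \<rho> where "\<rho> = spectral_norm d \<Sigma>"
  define R where "R = mat_trace d \<Sigma>"
  \<comment> \<open>This is \<open>\<rho> * real k * (eff_rank d \<Sigma> / real k + 1)\<close>, so
    \<open>q / real n\<close> has the order of the target
    \<open>s2 * \<delta>\<^sup>2\<close>.\<close>
  define q where "q = R + \<rho> * real k"
  define \<Lambda> where "\<Lambda> = 100 * \<beta>"
  have \<rho>: "0 < \<rho>" using nz by (simp add: \<rho>_def)
  have R: "0 \<le> R" using trace_cov_nonneg by (simp add: R_def)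
  have k0: "0 < real k" using k by simp
  have m0: "0 < real m" using k by (simp add: m div_greater_zero_iff)
  have n0: "0 < real n" using k by simp
  have q: "0 < q" "R \<le> q" "\<rho> * real k \<le> q" using \<rho> R k0 by (auto simp: q_def add_nonneg_pos)
  have \<beta>q: "\<beta> = 1000 * q / real m" by (simp add: \<beta> q_def R_def \<rho>_def)
  have \<beta>0: "0 < \<beta>" using q m0 by (simp add: \<beta>q)
  have r0: "0 < r" and r2: "r\<^sup>2 = 1 / \<beta>" using \<beta>0 by (auto simp: r power_divide)
  have \<Lambda>0: "0 < \<Lambda>" using \<beta>0 by (simp add: \<Lambda>_def)
  define Y where "Y B = block \<mu> B s" for B
  obtain U where w0: "\<And>B. B \<in> \<B> \<Longrightarrow> 0 \<le> cos_weight d U (Y B)"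
    and S: "\<Lambda> * (\<Sum>u\<leftarrow>U. ip d u u) \<le> (\<Sum>B\<in>\<B>. 1 - cos_weight d U (Y B))"
    and sec: "\<And>v. (\<Sum>B\<in>\<B>. cos_weight d U (Y B) * (ip d v (Y B))\<^sup>2) \<le> 8 * \<Lambda> * ip d v v"
    using ex_cos_weights[OF \<B>(1) \<Lambda>0, of d Y] by blast
  define T where "T = (\<Sum>u\<leftarrow>U. ip d u u)"
  define W where "W = (\<Sum>B\<in>\<B>. 1 - cos_weight d U (Y B))"
  have T0: "0 \<le> T" unfolding T_def by (intro sum_list_nonneg) (auto simp: ip_self_nonneg)
  \<comment> \<open>A bootstrap: nonnegative weights give the trivial bound
    \<open>W \<le> real k\<close>, hence a bound on \<open>T\<close>; inserted into the PAC-Bayes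
    bound, it improves to \<open>W \<le> real k / 100\<close>.\<close>
  have "W \<le> (\<Sum>B\<in>\<B>. 1)" unfolding W_def using w0 by (intro sum_mono) auto
  then have Wk: "W \<le> real k" using \<B>(2) by simp
  have TL: "T \<le> real k / \<Lambda>"
    using S Wk \<Lambda>0 by (simp add: T_def W_def field_simps)
  have "W \<le> c * ((\<Sum>u\<leftarrow>U. quad d \<Sigma> u) + r\<^sup>2 * R) + T / (2 * r\<^sup>2) + t"
    unfolding W_def T_def R_def Y_def
    using s w0 by (intro pac_bayes_cos r0 \<B>(1)) (auto simp: good_samples_def Y_def)
  also have "\<dots> \<le> c * (\<rho> * T + r\<^sup>2 * R) + T / (2 * r\<^sup>2) + t"
    using sum_list_quad_le[of d \<Sigma> U] k0 m0
    by (intro add_mono mult_left_mono) (auto simp: \<rho>_def T_def c)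
  also have "\<dots> \<le> c * (\<rho> * (real k / \<Lambda>) + q / \<beta>) + real k / \<Lambda> * \<beta> / 2 + real k / 500"
  proof (intro add_mono t)
    have "\<rho> * T \<le> \<rho> * (real k / \<Lambda>)" using TL \<rho> by (intro mult_left_mono) auto
    moreover have "r\<^sup>2 * R \<le> q / \<beta>" using q(2) \<beta>0 by (simp add: r2 divide_right_mono)
    ultimately show "c * (\<rho> * T + r\<^sup>2 * R) \<le> c * (\<rho> * (real k / \<Lambda>) + q / \<beta>)"
      by (rule mult_left_mono[OF add_mono]) (simp add: c)
    show "T / (2 * r\<^sup>2) \<le> real k / \<Lambda> * \<beta> / 2"
      using mult_right_mono[OF TL, of \<beta>] \<beta>0 by (simp add: r2)
  qed
  \<comment> \<open>The budget in units of \<open>real k\<close>: 0.00202 for the spectral and trace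
    terms, 0.005 for the entropy and 0.002 for \<open>t\<close>.\<close>
  also have "\<dots> \<le> real k / 100"
  proof -
    have "\<rho> * (real k / \<Lambda>) \<le> q / \<Lambda>" using q(3) \<Lambda>0 by (simp add: divide_right_mono)
    also have "q / \<Lambda> = real m / 100000" using q m0 by (simp add: \<Lambda>_def \<beta>q)
    finally have 1: "\<rho> * (real k / \<Lambda>) \<le> real m / 100000" .
    have 2: "q / \<beta> = real m / 1000" using q m0 by (simp add: \<beta>q)
    have "c * (\<rho> * (real k / \<Lambda>) + q / \<beta>) \<le> c * (real m / 100000 + real m / 1000)"
      using 1 2 k0 m0 by (intro mult_left_mono) (auto simp: c)
    also have "\<dots> = 202 / 100000 * real k" using m0 by (simp add: c field_simps)
    finally have 3: "c * (\<rho> * (real k / \<Lambda>) + q / \<beta>) \<le> 202 / 100000 * real k" .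
    have 4: "real k / \<Lambda> * \<beta> / 2 = real k / 200" using \<beta>0 by (simp add: \<Lambda>_def)
    have "c * (\<rho> * (real k / \<Lambda>) + q / \<beta>) + real k / \<Lambda> * \<beta> / 2 + real k / 500 \<le>
        202 / 100000 * real k + real k / 200 + real k / 500"
      by (rule add_mono[OF add_mono[OF 3 eq_refl[OF 4]] order_refl])
    also have "\<dots> \<le> real k / 100" using k0 by simp
    finally show ?thesis .
  qed
  finally have W: "W \<le> real k / 100" .
  define G where "G = {B \<in> \<B>. 1 / 2 \<le> cos_weight d U (Y B)}"
  have G: "G \<subseteq> \<B>" "finite G" using \<B>(1) by (auto simp: G_def)
  \<comment> \<open>Each discarded bucket contributes more than 1/2 to \<open>W\<close>, so at most
    a fiftieth of the buckets is lost.\<close>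
  have "real (card (\<B> - G)) * (1 / 2) = (\<Sum>B\<in>\<B> - G. 1 / 2)" by simp
  also have "\<dots> \<le> (\<Sum>B\<in>\<B> - G. 1 - cos_weight d U (Y B))"
    by (intro sum_mono) (auto simp: G_def)
  also have "\<dots> \<le> W"
    unfolding W_def using \<B>(1) cos_weight_le_1 by (intro sum_mono2) auto
  finally have "real (card (\<B> - G)) \<le> real k / 50" using W by simp
  moreover have "real (card (\<B> - G)) = real k - real (card G)"
    using G \<B> card_mono[OF \<B>(1) G(1)] by (simp add: card_Diff_subset of_nat_diff)
  ultimately have cG: "real (card G) \<ge> 0.98 * real k" by simp
  define S' where "S' = bucket_means d s G"
  have "mset_set G \<subseteq># mset_set \<B>" using G \<B>(1) by (simp add: subset_imp_msubset_mset_set)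
  then have sub: "S' \<subseteq># bucket_means d s \<B>"
    unfolding S'_def bucket_means_def by (rule image_mset_subseteq_mono)
  have size: "size S' = card G" by (simp add: S'_def bucket_means_def)
  \<comment> \<open>The factor 8 of \<open>sec\<close>, doubled because the weights on
    \<open>G\<close> are at least 1/2.\<close>
  define K where "K = 16 * \<Lambda>"
  have bound: "(\<Sum>x\<in>#S'. (ip d v (\<lambda>i. x i - \<mu> i))\<^sup>2) \<le> K * ip d v v" for v
  proof -
    have "(\<Sum>x\<in>#S'. (ip d v (\<lambda>i. x i - \<mu> i))\<^sup>2) = (\<Sum>B\<in>G. (ip d v (Y B))\<^sup>2)"
      by (simp add: S'_def bucket_means_def image_mset.compositionality o_def ip_emp_mean Y_def sum_unfold_sum_mset)
    also have "\<dots> \<le> (\<Sum>B\<in>G. 2 * (cos_weight d U (Y B) * (ip d v (Y B))\<^sup>2))"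
    proof (rule sum_mono)
      fix B assume "B \<in> G"
      then have "1 * (ip d v (Y B))\<^sup>2 \<le> (2 * cos_weight d U (Y B)) * (ip d v (Y B))\<^sup>2"
        by (intro mult_right_mono) (auto simp: G_def)
      then show "(ip d v (Y B))\<^sup>2 \<le> 2 * (cos_weight d U (Y B) * (ip d v (Y B))\<^sup>2)" by simp
    qed
    also have "\<dots> \<le> (\<Sum>B\<in>\<B>. 2 * (cos_weight d U (Y B) * (ip d v (Y B))\<^sup>2))"
      using G \<B>(1) w0 by (intro sum_mono2) auto
    also have "\<dots> = 2 * (\<Sum>B\<in>\<B>. cos_weight d U (Y B) * (ip d v (Y B))\<^sup>2)"
      by (simp add: sum_distrib_left)
    also have "\<dots> \<le> K * ip d v v" using sec[of v] by (simp add: K_def)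
    finally show ?thesis .
  qed
  define s2 where "s2 = real k * \<rho> / real n"
  have s20: "0 < s2" using k0 \<rho> n0 by (simp add: s2_def)
  \<comment> \<open>Fewer than \<open>k\<close> samples are dropped and
    \<open>k \<le> m * k\<close>, so the buckets use at least half of the samples.\<close>
  have mk: "real n \<le> 2 * (real m * real k)"
  proof -
    have "n = m * k + n mod k" by (simp add: m)
    moreover have "n mod k < k" using k by simp
    moreover have "k \<le> m * k" using m0 by simp
    ultimately have "n \<le> 2 * (m * k)" by linarith
    then have "real n \<le> real (2 * (m * k))" by (rule of_nat_mono)
    then show ?thesis by simp
  qed
  have KN: "K / (real k / 2) \<le> 6400000 * (q / real n)"
  proof -
    have "K / (real k / 2) = 3200000 * q / (real m * real k)"
      using m0 k0 by (simp add: K_def \<Lambda>_def \<beta>q field_simps)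
    also have "\<dots> \<le> 3200000 * q / (real n / 2)"
      using mk m0 k0 n0 q by (intro divide_left_mono mult_pos_pos) auto
    also have "\<dots> = 6400000 * (q / real n)" by simp
    finally show ?thesis .
  qed
  have s2\<delta>: "100000000 * (q / real n) \<le> s2 * \<delta>\<^sup>2"
  proof -
    define x where "x = eff_rank d \<Sigma> / real k"
    have x: "x = R / (\<rho> * real k)" by (simp add: x_def eff_rank_def R_def \<rho>_def)
    have x0: "0 \<le> x" using R \<rho> k0 by (simp add: x)
    have "x + 1 \<le> (sqrt x + 1)\<^sup>2" using x0 real_sqrt_ge_zero[OF x0] by (simp add: power2_eq_square algebra_simps)
    then have "100000000 * (s2 * (x + 1)) \<le> 100000000 * (s2 * (sqrt x + 1)\<^sup>2)"
      using s20 by (intro mult_left_mono) auto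
    also have "\<dots> = s2 * \<delta>\<^sup>2" unfolding \<delta> x_def[symmetric] power_mult_distrib by simp
    also have "s2 * (x + 1) = q / real n"
      using \<rho> k0 n0 by (simp add: s2_def x q_def field_simps)
    finally show ?thesis .
  qed
  have s2q: "s2 \<le> q / real n" using q(3) n0 by (simp add: s2_def divide_right_mono mult.commute)
  have qn: "0 < q / real n" using q n0 by simp
  have "is_stable d 0.1 \<delta> \<mu> s2 S'"
  proof (rule stable_of_second_moment_bound[where N = "real k / 2" and K = K])
    show "0 \<le> K" using \<Lambda>0 by (simp add: K_def)
    show "real k / 2 \<le> 0.9 * real (size S')" using cG k0 by (simp add: size)
    show "0.1 \<le> \<delta>"
    proof -
      have "0 \<le> sqrt (eff_rank d \<Sigma> / real k)"
        using R \<rho> k0 by (simp add: eff_rank_def R_def \<rho>_def)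
      then show ?thesis by (simp add: \<delta>)
    qed
    show "K / (real k / 2) \<le> s2 * \<delta>\<^sup>2" using KN s2\<delta> qn by linarith
    then show "K / (real k / 2) + s2 \<le> s2 * \<delta>\<^sup>2 / 0.1" using KN s2\<delta> qn s2q by simp
  qed (use bound k0 s20 in auto)
  then show ?thesis using sub cG k0 by (intro exI[of _ S']) (auto simp: s2_def \<rho>_def size)
qed

end

section \<open>The event under the joint law of samples and bucketing\<close>

lemma space_sample_space: "space (sample_space d n) = ({..<n} \<rightarrow>\<^sub>E ({..<d} \<rightarrow>\<^sub>E UNIV))"
  by (simp add: sample_space_def Rd_def space_PiM)

lemma measurable_sample_coordinate [measurable]:
  "i < n \<Longrightarrow> l < d \<Longrightarrow> (\<lambda>s. s i l) \<in> borel_measurable (sample_space d n)"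
  unfolding sample_space_def Rd_def
  by (rule measurable_compose[where N = "\<Pi>\<^sub>M i\<in>{..<d}. borel"]) measurable

text \<open>The event asks for some aligning permutation, which need not be chosen measurably. For a fixed pair of
  samples with an aligning \<open>\<pi>\<close>, the bijection \<open>\<B> \<mapsto> \<pi>(\<B>)\<close> shows that at least as many bucketings satisfy
  the event as are good.\<close>

lemma bucketing_event:
  fixes good :: "nat set set \<Rightarrow> (nat \<Rightarrow> nat \<Rightarrow> real) set"
  assumes law: "corrupted_sample_law d n \<epsilon> P L" and k: "1 \<le> k" "k \<le> n"
    and good: "\<And>\<B>. \<B> \<in> bucketings n k \<Longrightarrow> good \<B> \<in> sets (PiM {..<n} (\<lambda>_. P))"
    and prob: "\<And>\<B>. \<B> \<in> bucketings n k \<Longrightarrow> p \<le> measure (PiM {..<n} (\<lambda>_. P)) (good \<B>)"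
    and sets_P: "sets P = sets (Rd d)"
  defines "M \<equiv> L \<Otimes>\<^sub>M uniform_count_measure (bucketings n k)"
  shows "\<exists>E\<in>sets M. p \<le> measure M E \<and> (\<forall>((s, t), \<B>)\<in>E. \<B> \<in> bucketings n k \<and> s \<in> space (sample_space d n) \<and>
    t \<in> space (sample_space d n) \<and> (\<exists>\<pi>. \<pi> permutes {..<n} \<and>
      real (card {i\<in>{..<n}. t i \<noteq> s (\<pi> i)}) \<le> \<epsilon> * real n \<and> s \<in> good ((`) \<pi> ` \<B>)))"
proof -
  define N where "N = bucketings n k"
  have finN: "finite N" and N0: "0 < real (card N)"
    using finite_bucketings bucketings_nonempty[OF k] by (auto simp: N_def card_gt_0_iff)
  interpret L: prob_space L using law by (simp add: corrupted_sample_law_def)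
  have sets_L: "sets L = sets (sample_space d n \<Otimes>\<^sub>M sample_space d n)"
    and marginal: "distr L (sample_space d n) fst = PiM {..<n} (\<lambda>_. P)"
    and corr: "AE (s, t) in L. corrupted \<epsilon> (points t {..<n}) (points s {..<n})"
    using law by (auto simp: corrupted_sample_law_def)
  note [measurable_cong] = sets_L
  have space_L: "space L = space (sample_space d n) \<times> space (sample_space d n)"
    using sets_eq_imp_space_eq[OF sets_L] by (simp add: space_pair_measure)
  have sets_Q: "sets (PiM {..<n} (\<lambda>_. P)) = sets (sample_space d n)"
    unfolding sample_space_def by (intro sets_PiM_cong refl sets_P)
  have U: "prob_space (uniform_count_measure N)"
    using finN N0 by (intro prob_space_uniform_count_measure) auto
  interpret U: prob_space "uniform_count_measure N" by (rule U)
  interpret M: prob_space M unfolding M_def N_def[symmetric]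
    by (intro prob_space_pair L.prob_space_axioms U)
  define A where "A \<pi> = {x \<in> space L. real (card {i\<in>{..<n}. snd x i \<noteq> fst x (\<pi> i)}) \<le> \<epsilon> * real n}" for \<pi>
  have A: "A \<pi> \<in> sets L" if \<pi>: "\<pi> permutes {..<n}" for \<pi>
  proof -
    have \<pi>n: "\<pi> i < n" if "i < n" for i using permutes_in_image[OF \<pi>, of i] that by simp
    \<comment> \<open>Sample points are extensional, so their equality reduces to finitely many real
      coordinates and the count becomes a measurable sum.\<close>
    have eq: "real (card {i\<in>{..<n}. snd x i \<noteq> fst x (\<pi> i)}) =
        (\<Sum>i<n. if \<forall>l\<in>{..<d}. snd x i l = fst x (\<pi> i) l then 0 else 1)" if "x \<in> space L" for x
    proof -
      have "(snd x i = fst x (\<pi> i)) = (\<forall>l\<in>{..<d}. snd x i l = fst x (\<pi> i) l)" if "i < n" for i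
      proof
        have "snd x i \<in> extensional {..<d}" "fst x (\<pi> i) \<in> extensional {..<d}"
          using \<open>x \<in> space L\<close> \<open>i < n\<close> \<pi>n[OF \<open>i < n\<close>]
          by (auto simp: space_L space_sample_space PiE_iff)
        then show "\<forall>l\<in>{..<d}. snd x i l = fst x (\<pi> i) l \<Longrightarrow> snd x i = fst x (\<pi> i)"
          by (rule extensionalityI) auto
      qed simp
      then have "{i\<in>{..<n}. snd x i \<noteq> fst x (\<pi> i)} = {i\<in>{..<n}. \<not> (\<forall>l\<in>{..<d}. snd x i l = fst x (\<pi> i) l)}"
        by auto
      then show ?thesis by (simp add: sum.If_cases Int_def)
    qed
    have [measurable]: "(\<lambda>x. snd x i l) \<in> borel_measurable L" "(\<lambda>x. fst x (\<pi> i) l) \<in> borel_measurable L"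
      if "i < n" "l < d" for i l
      using measurable_compose[OF measurable_snd measurable_sample_coordinate[OF that]]
        measurable_compose[OF measurable_fst measurable_sample_coordinate[OF \<pi>n[OF that(1)] that(2)]]
      by (simp_all add: measurable_cong_sets[OF sets_L refl])
    have "{x \<in> space L. (\<Sum>i<n. if \<forall>l\<in>{..<d}. snd x i l = fst x (\<pi> i) l then 0 else 1) \<le> \<epsilon> * real n} \<in> sets L"
      by measurable
    also have "{x \<in> space L. (\<Sum>i<n. if \<forall>l\<in>{..<d}. snd x i l = fst x (\<pi> i) l then 0 else 1) \<le> \<epsilon> * real n} = A \<pi>"
      unfolding A_def by (intro Collect_cong conj_cong refl) (simp only: eq)
    finally show ?thesis .
  qed
  define H where "H \<B> = fst -` good \<B> \<inter> space L" for \<B>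
  have goodQ: "good \<B> \<in> sets (sample_space d n)" if "\<B> \<in> N" for \<B>
    using good that by (simp add: N_def sets_Q)
  have fst_meas: "fst \<in> L \<rightarrow>\<^sub>M sample_space d n" by measurable
  have H: "H \<B> \<in> sets L" if "\<B> \<in> N" for \<B>
    unfolding H_def using fst_meas goodQ[OF that] by (rule measurable_sets)
  have probH: "p \<le> L.prob (H \<B>)" if "\<B> \<in> N" for \<B>
    using prob[of \<B>] that measure_distr[OF fst_meas goodQ[OF that]] by (simp add: H_def marginal N_def)
  have perm: "(`) \<pi> ` \<B> \<in> N" if "\<pi> permutes {..<n}" "\<B> \<in> N" for \<pi> \<B>
    using bij_betw_bucketings[OF that(1), of k] that(2) by (auto simp: bij_betw_def N_def)
  define E0 where "E0 \<B> = (\<Union>\<pi>\<in>{\<pi>. \<pi> permutes {..<n}}. A \<pi> \<inter> H ((`) \<pi> ` \<B>))" for \<B>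
  have E0: "E0 \<B> \<in> sets L" if "\<B> \<in> N" for \<B>
    unfolding E0_def using that by (intro sets.finite_UN sets.Int A H perm finite_permutations) auto
  define E where "E = (\<Union>\<B>\<in>N. E0 \<B> \<times> {\<B>})"
  have box: "E0 \<B> \<times> {\<B>} \<in> sets M" if "\<B> \<in> N" for \<B>
    unfolding M_def N_def[symmetric] using E0[OF that] that
    by (intro pair_measureI) (auto simp: sets_uniform_count_measure)
  have E: "E \<in> sets M" unfolding E_def using finN box by (intro sets.finite_UN) auto
  have meas_box: "measure M (E0 \<B> \<times> {\<B>}) = L.prob (E0 \<B>) / real (card N)" if "\<B> \<in> N" for \<B>
  proof -
    have "measure M (E0 \<B> \<times> {\<B>}) = L.prob (E0 \<B>) * U.prob {\<B>}"
      unfolding M_def N_def[symmetric] using E0[OF that] that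
      by (simp add: measure_def U.emeasure_pair_measure_Times sets_uniform_count_measure enn2real_mult)
    also have "U.prob {\<B>} = 1 / real (card N)"
      using finN that by (simp add: measure_uniform_count_measure)
    finally show ?thesis by simp
  qed
  have "measure M E = (\<Sum>\<B>\<in>N. measure M (E0 \<B> \<times> {\<B>}))"
    unfolding E_def using box finN
    by (intro M.finite_measure_finite_Union) (auto simp: disjoint_family_on_def)
  also have "\<dots> = (\<Sum>\<B>\<in>N. L.prob (E0 \<B>)) / real (card N)"
    by (simp add: meas_box sum_divide_distrib)
  finally have ME: "measure M E = (\<Sum>\<B>\<in>N. L.prob (E0 \<B>)) / real (card N)" .
  \<comment> \<open>The comparison with \<open>E0\<close> is made pointwise under the integral and
    after summing over all bucketings: \<open>\<pi>\<close> varies with the pair of samples, and the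
    sum is invariant under each \<open>\<pi>\<close>.\<close>
  have "real (card N) * p \<le> (\<Sum>\<B>\<in>N. L.prob (H \<B>))"
    using sum_mono[of N "\<lambda>_. p", OF probH] by simp
  also have "\<dots> = (\<Sum>\<B>\<in>N. \<integral>x. indicator (H \<B>) x \<partial>L)"
    using H by (intro sum.cong) auto
  also have "\<dots> = (\<integral>x. (\<Sum>\<B>\<in>N. indicator (H \<B>) x) \<partial>L)"
    using H by (intro Bochner_Integration.integral_sum[symmetric]) (auto simp: L.emeasure_eq_measure)
  also have "\<dots> \<le> (\<integral>x. (\<Sum>\<B>\<in>N. indicator (E0 \<B>) x) \<partial>L)"
  proof (rule integral_mono_AE)
    show "integrable L (\<lambda>x. \<Sum>\<B>\<in>N. indicator (H \<B>) x :: real)"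
      using H by (intro Bochner_Integration.integrable_sum) (auto simp: L.emeasure_eq_measure)
    show "integrable L (\<lambda>x. \<Sum>\<B>\<in>N. indicator (E0 \<B>) x :: real)"
      using E0 by (intro Bochner_Integration.integrable_sum) (auto simp: L.emeasure_eq_measure)
    show "AE x in L. (\<Sum>\<B>\<in>N. indicator (H \<B>) x) \<le> (\<Sum>\<B>\<in>N. indicator (E0 \<B>) x :: real)"
      using corr AE_space
    proof eventually_elim
      case (elim x)
      obtain s t where x: "x = (s, t)" by (cases x)
      obtain \<pi> where \<pi>: "\<pi> permutes {..<n}" "real (card {i\<in>{..<n}. t i \<noteq> s (\<pi> i)}) \<le> \<epsilon> * real (card {..<n})"
        using elim x by (auto elim: corrupted_alignment[rotated])
      then have "x \<in> A \<pi>" using elim by (simp add: A_def x)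
      then have "x \<in> E0 \<B>" if "x \<in> H ((`) \<pi> ` \<B>)" for \<B>
        using that \<pi>(1) by (auto simp: E0_def)
      then have "(\<Sum>\<B>\<in>N. indicator (H ((`) \<pi> ` \<B>)) x :: real) \<le> (\<Sum>\<B>\<in>N. indicator (E0 \<B>) x)"
        by (intro sum_mono) (auto simp: indicator_def)
      also have "(\<Sum>\<B>\<in>N. indicator (H ((`) \<pi> ` \<B>)) x :: real) = (\<Sum>\<B>\<in>N. indicator (H \<B>) x)"
        using bij_betw_bucketings[OF \<pi>(1), of k] unfolding N_def by (rule sum.reindex_bij_betw)
      finally show ?case .
    qed
  qed
  also have "\<dots> = (\<Sum>\<B>\<in>N. \<integral>x. indicator (E0 \<B>) x \<partial>L)"
    using E0 by (intro Bochner_Integration.integral_sum) (auto simp: L.emeasure_eq_measure)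
  also have "\<dots> = (\<Sum>\<B>\<in>N. L.prob (E0 \<B>))"
    using E0 by (intro sum.cong) auto
  finally have "p \<le> measure M E" using N0 by (simp add: ME field_simps)
  moreover have "\<B> \<in> bucketings n k \<and> s \<in> space (sample_space d n) \<and> t \<in> space (sample_space d n) \<and>
      (\<exists>\<pi>. \<pi> permutes {..<n} \<and> real (card {i\<in>{..<n}. t i \<noteq> s (\<pi> i)}) \<le> \<epsilon> * real n \<and> s \<in> good ((`) \<pi> ` \<B>))"
    if mem: "((s, t), \<B>) \<in> E" for s t \<B>
  proof -
    obtain \<pi> where \<pi>: "\<B> \<in> N" "\<pi> permutes {..<n}" "(s, t) \<in> A \<pi>" "(s, t) \<in> H ((`) \<pi> ` \<B>)"
      using mem by (auto simp: E_def E0_def)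
    then show ?thesis by (auto simp: A_def H_def N_def space_L)
  qed
  ultimately show ?thesis using E by (intro bexI[of _ E]) auto
qed

theorem theorem3p3:
  shows "\<exists>C1 C2 :: real. C1 > 0 \<and> C2 > 0 \<and>
    (\<forall>(d::nat) (n::nat) (\<epsilon>::real) (\<tau>::real) P L (\<epsilon>'::real) (k::nat) \<mu> \<Sigma> (\<delta>::real).
       d \<ge> 1 \<and> n \<ge> 1 \<and> 0 < \<epsilon> \<and> \<epsilon> < 1/2 \<and> 0 < \<tau> \<and> \<tau> < 1 \<and>
       prob_space P \<and> sets P = sets (Rd d) \<and>
       (\<forall>i<d. integrable P (\<lambda>x. (x i)\<^sup>2)) \<and>
       \<mu> = mean_vec P \<and> \<Sigma> = cov_mat P \<and> (\<exists>i<d. \<exists>j<d. \<Sigma> i j \<noteq> 0) \<and>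
       corrupted_sample_law d n \<epsilon> P L \<and>
       \<epsilon>' = C1 * (\<epsilon> + ln (1 / \<tau>) / real n) \<and> k = nat \<lfloor>\<epsilon>' * real n\<rfloor> \<and> 1 \<le> k \<and> k \<le> n \<and>
       \<delta> = C2 * (sqrt (eff_rank d \<Sigma> / real k) + 1)
       \<longrightarrow>
       (let M = L \<Otimes>\<^sub>M uniform_count_measure (bucketings n k) in
        \<exists>E \<in> sets M. measure M E \<ge> 1 - \<tau> \<and>
          (\<forall>((s, t), \<B>) \<in> E. \<exists>Sk.
             set_mset Sk \<subseteq> space (Rd d) \<and> size Sk = k \<and>
             corrupted 0.01 (bucket_means d t \<B>) Sk \<and>
             (\<exists>Sk'. Sk' \<subseteq># Sk \<and> real (size Sk') \<ge> 0.95 * real k \<and>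
                is_stable d 0.1 \<delta> \<mu> (real k * spectral_norm d \<Sigma> / real n) Sk'))))"
proof (rule exI[of _ 1000], rule exI[of _ 10000], intro conjI allI impI)
  \<comment> \<open>The value 1000 leaves room for \<open>t \<le> real k / 500\<close> and for at
    most \<open>0.01 * real k\<close> corrupted points despite the rounding in \<open>k\<close>. The
    square of 10000 exceeds the factor 6400000 in \<open>good_samples_imp_stable\<close>.\<close>
  fix d n :: nat and \<epsilon> \<tau> :: real and P L and \<epsilon>' :: real and k :: nat and \<mu> \<Sigma> and \<delta> :: real
  assume asm: "d \<ge> 1 \<and> n \<ge> 1 \<and> 0 < \<epsilon> \<and> \<epsilon> < 1/2 \<and> 0 < \<tau> \<and> \<tau> < 1 \<and>
       prob_space P \<and> sets P = sets (Rd d) \<and>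
       (\<forall>i<d. integrable P (\<lambda>x. (x i)\<^sup>2)) \<and>
       \<mu> = mean_vec P \<and> \<Sigma> = cov_mat P \<and> (\<exists>i<d. \<exists>j<d. \<Sigma> i j \<noteq> 0) \<and>
       corrupted_sample_law d n \<epsilon> P L \<and>
       \<epsilon>' = 1000 * (\<epsilon> + ln (1 / \<tau>) / real n) \<and> k = nat \<lfloor>\<epsilon>' * real n\<rfloor> \<and> 1 \<le> k \<and> k \<le> n \<and>
       \<delta> = 10000 * (sqrt (eff_rank d \<Sigma> / real k) + 1)"
  then have n: "1 \<le> n" and \<epsilon>: "0 < \<epsilon>" and \<tau>: "0 < \<tau>" "\<tau> < 1" and k: "1 \<le> k" "k \<le> n"
    and \<mu>: "\<mu> = mean_vec P" and \<Sigma>: "\<Sigma> = cov_mat P" and nz: "\<exists>i<d. \<exists>j<d. \<Sigma> i j \<noteq> 0"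
    and law: "corrupted_sample_law d n \<epsilon> P L" and \<delta>: "\<delta> = 10000 * (sqrt (eff_rank d \<Sigma> / real k) + 1)"
    and \<epsilon>': "\<epsilon>' = 1000 * (\<epsilon> + ln (1 / \<tau>) / real n)" and k_def: "k = nat \<lfloor>\<epsilon>' * real n\<rfloor>"
    and sets_P: "sets P = sets (Rd d)"
    by blast+
  interpret finite_covariance P d
    using asm by (auto simp: finite_covariance_def finite_covariance_axioms_def)
  \<comment> \<open>With this choice the failure probability \<open>exp (- t)\<close> of
    \<open>good_samples_prob\<close> is exactly \<open>\<tau>\<close>.\<close>
  define t where "t = ln (1 / \<tau>)"
  have t0: "0 \<le> t" and exp_t: "exp (- t) = \<tau>" using \<tau> by (auto simp: t_def ln_div)
  \<comment> \<open>Rounding down loses less than 1, and \<open>1 \<le> k\<close> turns this loss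
    into a factor of 2.\<close>
  have "\<epsilon>' * real n < 2 * real k"
  proof -
    have "\<epsilon>' * real n < real_of_int \<lfloor>\<epsilon>' * real n\<rfloor> + 1" by linarith
    also have "\<dots> = real k + 1" using k(1) by (simp add: k_def)
    finally show ?thesis using k(1) by linarith
  qed
  moreover have "\<epsilon>' * real n = 1000 * (\<epsilon> * real n) + 1000 * t"
    using n by (simp add: \<epsilon>' t_def field_simps)
  moreover have "0 < \<epsilon> * real n" using \<epsilon> n by simp
  ultimately have \<epsilon>n: "\<epsilon> * real n \<le> 0.01 * real k" and tk: "t \<le> real k / 500"
    using t0 by auto
  define m where "m = n div k"
  have m: "0 < m" using k by (simp add: m_def div_greater_zero_iff)
  have \<rho>: "0 < spectral_norm d \<Sigma>" using nz spectral_norm_pos by blast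
  define \<beta> where "\<beta> = 1000 * (mat_trace d \<Sigma> + spectral_norm d \<Sigma> * real k) / real m"
  define r where "r = 1 / sqrt \<beta>"
  have "0 < \<beta>" using \<rho> k m trace_cov_nonneg by (simp add: \<beta>_def \<Sigma> add_nonneg_pos)
  then have r: "0 < r" by (simp add: r_def)
  define c where "c = 2 * real k / real m"
  define good where "good = good_samples {..<n} c r t"
  have "0 \<in> {..<n}" using n by simp
  then have J: "finite {..<n}" "{..<n} \<noteq> {}" by (simp, blast)
  have good: "good \<B> \<in> sets (PiM {..<n} (\<lambda>_. P))" "1 - \<tau> \<le> measure (PiM {..<n} (\<lambda>_. P)) (good \<B>)"
    if "\<B> \<in> bucketings n k" for \<B>
    using good_samples_prob[OF J bucketingsD(5,1,2)[OF that] m, of c r t] bucketingsD(3,4)[OF that] r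
    by (simp_all add: good_def c_def m_def exp_t)
  let ?M = "L \<Otimes>\<^sub>M uniform_count_measure (bucketings n k)"
  obtain E where E: "E \<in> sets ?M" and ME_ev: "1 - \<tau> \<le> measure ?M E \<and> (\<forall>((s, t), \<B>)\<in>E. \<B> \<in> bucketings n k \<and> s \<in> space (sample_space d n) \<and>
      t \<in> space (sample_space d n) \<and> (\<exists>\<pi>. \<pi> permutes {..<n} \<and>
      real (card {i\<in>{..<n}. t i \<noteq> s (\<pi> i)}) \<le> \<epsilon> * real n \<and> s \<in> good ((`) \<pi> ` \<B>)))"
    by (rule bexE[OF bucketing_event[OF law k good sets_P]])
  note ev = conjunct2[OF ME_ev]
  have "\<exists>Sk. set_mset Sk \<subseteq> space (Rd d) \<and> size Sk = k \<and> corrupted 0.01 (bucket_means d u \<B>) Sk \<and>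
      (\<exists>Sk'. Sk' \<subseteq># Sk \<and> real (size Sk') \<ge> 0.95 * real k \<and>
        is_stable d 0.1 \<delta> \<mu> (real k * spectral_norm d \<Sigma> / real n) Sk')"
    if "((s, u), \<B>) \<in> E" for s u \<B>
  proof -
    from bspec[OF ev that] obtain \<pi> where \<B>: "\<B> \<in> bucketings n k" and \<pi>: "\<pi> permutes {..<n}"
      and bad: "real (card {i\<in>{..<n}. u i \<noteq> s (\<pi> i)}) \<le> \<epsilon> * real n" and sg: "s \<in> good ((`) \<pi> ` \<B>)"
      by auto
    \<comment> \<open>The clean bucket means are read in two ways: under the enumeration
      \<open>s (\<pi> i)\<close> they differ from those of \<open>u\<close> in few buckets, and as
      means of \<open>s\<close> over the transported bucketing they contain the stable
      subset.\<close>
    define Sk where "Sk = bucket_means d (\<lambda>i. s (\<pi> i)) \<B>"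
    have \<pi>\<B>: "(`) \<pi> ` \<B> \<in> bucketings n k"
      using bij_betw_bucketings[OF \<pi>, of k] \<B> by (auto simp: bij_betw_def)
    have Sk: "Sk = bucket_means d s ((`) \<pi> ` \<B>)"
      unfolding Sk_def using permutes_inj[OF \<pi>] by (rule bucket_means_permute)
    have "emp_mean d X \<in> space (Rd d)" for X
      by (simp add: emp_mean_def Rd_def space_PiM)
    then have "set_mset Sk \<subseteq> space (Rd d)"
      by (auto simp: Sk_def bucket_means_def)
    moreover have "size Sk = k" using bucketingsD(3)[OF \<B>] by (simp add: Sk_def bucket_means_def)
    moreover have "corrupted 0.01 (bucket_means d u \<B>) Sk"
      unfolding Sk_def using bad \<epsilon>n bucketingsD(3)[OF \<B>]
      by (intro corrupted_bucket_means[OF bucketingsD(5,1,2)[OF \<B>] J(1)]) auto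
    moreover have "\<exists>Sk'. Sk' \<subseteq># Sk \<and> real (size Sk') \<ge> 0.95 * real k \<and>
        is_stable d 0.1 \<delta> \<mu> (real k * spectral_norm d \<Sigma> / real n) Sk'"
      unfolding Sk \<mu> \<Sigma> using k bucketingsD(5,3,4)[OF \<pi>\<B>] \<rho> tk sg
      by (intro good_samples_imp_stable[where m = m and c = c and \<beta> = \<beta> and r = r and t = t and J = "{..<n}"])
        (auto simp: m_def c_def \<beta>_def r_def good_def \<Sigma> \<delta>)
    ultimately show ?thesis by blast
  qed
  then show "let M = ?M in \<exists>E\<in>sets M. 1 - \<tau> \<le> measure M E \<and>
      (\<forall>((s, t), \<B>)\<in>E. \<exists>Sk. set_mset Sk \<subseteq> space (Rd d) \<and> size Sk = k \<and>
        corrupted 0.01 (bucket_means d t \<B>) Sk \<and>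
        (\<exists>Sk'. Sk' \<subseteq># Sk \<and> 0.95 * real k \<le> real (size Sk') \<and>
          is_stable d 0.1 \<delta> \<mu> (real k * spectral_norm d \<Sigma> / real n) Sk'))"
    unfolding Let_def using E conjunct1[OF ME_ev] by (intro bexI[of _ E] conjI) (auto simp del: One_nat_def)
qed simp_all

end
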